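(* Let $f \colon \mathbb{C} \rightarrow \mathbb{C}$ be a unicritical polynomial map such that the multiplier of $f$ at each of its cycles is a rational number. Then $f$ is either a power map or a Chebyshev map.
   Context: A point $z_0 \in \mathbb{C}$ is periodic for a polynomial map $f \colon \mathbb{C} \to \mathbb{C}$ if $f^{\circ n}(z_0) = z_0$ for some integer $n \geq 1$; the least such $n$ is its period, and its forward orbit (which has cardinality $n$) is called a cycle. The multiplier of $f$ at $z_0$ (equivalently, at its cycle) is $(f^{\circ n})'(z_0)$, where $n$ is the period of $z_0$; it is the same at every point of the cycle. A polynomial map is unicritical if it has degree $d \geq 2$ and has a unique critical point in $\mathbb{C}$. A polynomial map $f$ of degree $d \geq 2$ is a power map if it is affinely conjugate to $z \mapsto z^d$ (i.e. $\phi \circ f = g \circ \phi$ for some invertible affine map $\phi$, with $g(z) = z^d$). For $d \geq 2$, $T_d \in \mathbb{C}[z]$ denotes the unique polynomial such that $T_d(z + z^{-1}) = z^d + z^{-d}$. A polynomial map of degree $d \geq 2$ is a Chebyshev map if it is affinely conjugate to $T_d$ or to $-T_d$. *)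

theory Defs
  imports "HOL-Analysis.Analysis" "HOL-Computational_Algebra.Polynomial"
begin

definition periodic_point :: "('a \<Rightarrow> 'a) \<Rightarrow> 'a \<Rightarrow> bool" where
  "periodic_point f z \<longleftrightarrow> (\<exists>n\<ge>1. (f ^^ n) z = z)"

text \<open>Only meaningful at periodic points; for other points the \<open>LEAST\<close> is unspecified.\<close>

definition period_at :: "('a \<Rightarrow> 'a) \<Rightarrow> 'a \<Rightarrow> nat" where
  "period_at f z = (LEAST n. n \<ge> 1 \<and> (f ^^ n) z = z)"

definition multiplier :: "(complex \<Rightarrow> complex) \<Rightarrow> complex \<Rightarrow> complex" where
  "multiplier f z = deriv (f ^^ period_at f z) z"

definition unicritical :: "complex poly \<Rightarrow> bool" where
  "unicritical p \<longleftrightarrow> degree p \<ge> 2 \<and> (\<exists>!c. poly (pderiv p) c = 0)"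

definition affinely_conjugate :: "(complex \<Rightarrow> complex) \<Rightarrow> (complex \<Rightarrow> complex) \<Rightarrow> bool" where
  "affinely_conjugate f g \<longleftrightarrow>
     (\<exists>a b. a \<noteq> 0 \<and> (\<lambda>z. a * z + b) \<circ> f = g \<circ> (\<lambda>z. a * z + b))"

definition power_map :: "complex poly \<Rightarrow> bool" where
  "power_map p \<longleftrightarrow> degree p \<ge> 2 \<and> affinely_conjugate (poly p) (\<lambda>z. z ^ degree p)"

text \<open>
  This is the monic normalisation of the Chebyshev polynomial (so \<open>chebyshev_T 2\<close> is
  \<open>X^2 - 2\<close>), not the one with \<open>T (cos x) = cos (d * x)\<close>. The description is justified by
  \<open>chebyshev_T_ex1\<close> below.
\<close>

definition chebyshev_T :: "nat \<Rightarrow> complex poly" where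
  "chebyshev_T d = (THE T. \<forall>z. z \<noteq> 0 \<longrightarrow> poly T (z + inverse z) = z ^ d + inverse z ^ d)"

definition chebyshev_map :: "complex poly \<Rightarrow> bool" where
  "chebyshev_map p \<longleftrightarrow> degree p \<ge> 2 \<and>
     (affinely_conjugate (poly p) (poly (chebyshev_T (degree p))) \<or>
      affinely_conjugate (poly p) (poly (- chebyshev_T (degree p))))"

lemma chebyshev_T_exists:
  "\<exists>T :: complex poly. \<forall>z. z \<noteq> 0 \<longrightarrow> poly T (z + inverse z) = z ^ d + inverse z ^ d"
proof (induction d rule: less_induct)
  case (less d)
  consider "d = 0" | "d = 1" | n where "d = Suc (Suc n)"
    by (metis One_nat_def not0_implies_Suc)
  then show ?case
  proof cases
    case 1
    then show ?thesis by (intro exI[of _ "[:2:]"]) simp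
  next
    case 2
    then show ?thesis by (intro exI[of _ "[:0, 1:]"]) simp
  next
    case 3
    obtain S :: "complex poly" where S: "\<And>z. z \<noteq> 0 \<Longrightarrow> poly S (z + inverse z) = z ^ Suc n + inverse z ^ Suc n"
      using less[of "Suc n"] 3 by blast
    obtain R :: "complex poly" where R: "\<And>z. z \<noteq> 0 \<Longrightarrow> poly R (z + inverse z) = z ^ n + inverse z ^ n"
      using less[of n] 3 by auto
    have "poly ([:0, 1:] * S - R) (z + inverse z) = z ^ d + inverse z ^ d" if "z \<noteq> 0" for z
    proof -
      have 1: "z * (inverse z * x) = x" "inverse z * (z * x) = x" for x
        using that by (simp_all add: mult.assoc[symmetric])
      have "(z + inverse z) * (z ^ Suc n + inverse z ^ Suc n) - (z ^ n + inverse z ^ n)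
          = z ^ Suc (Suc n) + inverse z ^ Suc (Suc n)"
        unfolding power_Suc distrib_left distrib_right 1 by simp
      then show ?thesis
        unfolding 3 poly_diff poly_mult S[OF that] R[OF that] by simp
    qed
    then show ?thesis by blast
  qed
qed

lemma add_inverse_surj: "\<exists>z. z \<noteq> 0 \<and> z + inverse z = (w :: complex)"
proof -
  define s where "s = csqrt (w ^ 2 - 4)"
  define z where "z = (w + s) / 2"
  have "s ^ 2 = w ^ 2 - 4" by (simp add: s_def)
  moreover have "z * (w - z) = (w ^ 2 - s ^ 2) / 4"
    by (simp add: z_def field_simps power2_eq_square)
  ultimately have *: "z * (w - z) = 1" by simp
  then have "z \<noteq> 0" by auto
  moreover have "inverse z = w - z" using * by (rule inverse_unique)
  ultimately show ?thesis by auto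
qed

lemma chebyshev_T_ex1:
  "\<exists>!T :: complex poly. \<forall>z. z \<noteq> 0 \<longrightarrow> poly T (z + inverse z) = z ^ d + inverse z ^ d"
proof (rule ex_ex1I[OF chebyshev_T_exists])
  fix S T :: "complex poly"
  assume S: "\<forall>z. z \<noteq> 0 \<longrightarrow> poly S (z + inverse z) = z ^ d + inverse z ^ d"
    and T: "\<forall>z. z \<noteq> 0 \<longrightarrow> poly T (z + inverse z) = z ^ d + inverse z ^ d"
  have "poly S w = poly T w" for w
    using add_inverse_surj[of w] S T by metis
  then show "S = T" by (simp add: poly_eq_poly_eq_iff[symmetric] fun_eq_iff)
qed

lemma poly_chebyshev_T:
  "z \<noteq> 0 \<Longrightarrow> poly (chebyshev_T d) (z + inverse z) = z ^ d + inverse z ^ d"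
  using theI'[OF chebyshev_T_ex1[of d]] unfolding chebyshev_T_def by blast

end

theory Submission
  imports Defs "HOL-Computational_Algebra.Nth_Powers"
    "HOL-Computational_Algebra.Fundamental_Theorem_Algebra"
begin

text \<open>
  After an affine conjugation \<open>f\<close> is \<open>z^d + c\<close>; suppose \<open>c \<noteq> 0\<close>. At a fixed point \<open>z\<close> the number
  \<open>1 - z^(d-1) = c/z\<close> is rational, so all fixed points lie on the line \<open>\<real>c\<close>. For \<open>d \<ge> 4\<close> the sum of
  their squares vanishes, which is impossible. For \<open>d = 3\<close> this sum is \<open>2\<close>, whence \<open>c^2 > 0\<close>; the
  2-cycles correspond to the roots \<open>u\<close> of \<open>(u - 1) (u + 1)^2 = c^2\<close> with multiplier \<open>9 u^2\<close>, and
  realness of all the \<open>u^2\<close> forces all three roots to be greater than \<open>1\<close>, although their sum is \<open>-1\<close>.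

  For \<open>d = 2\<close> the 4-cycles correspond to the roots \<open>T\<close> of \<open>T^3 + (3 + 4c) T + 4 = 0\<close> (\<open>T\<close> being the
  sum of the cycle), with multiplier \<open>8c (T^2 + T) + 16 (1 + c + c^2)\<close>. If these are rational, then
  \<open>c = -2\<close> or all roots \<open>T\<close> are rational. In the latter case two of the roots satisfy
  \<open>x y (x + y) = 4\<close>, which has no rational solution: it leads to \<open>a^3 + b^3 = 4 c^3\<close> in integers,
  which is excluded by Euler's descent.
\<close>

subsection \<open>Cubes of the form p^2 + 3 q^2\<close>

text \<open>Thue's pigeonhole argument. With \<open>m\<close> the integer square root of
  \<open>P\<close> there are \<open>(m + 1)^2 > P\<close> pairs in the box, so two of them give the
  same residue of \<open>u x - v y\<close>, and their difference is the desired pair. Since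
  \<open>P\<close> is not a square, \<open>m^2 < P\<close> is strict.\<close>

lemma thue_int:
  fixes P u v :: int
  assumes "P > 0" "\<And>m. P \<noteq> m ^ 2"
  obtains a b where "(a, b) \<noteq> (0, 0)" "a ^ 2 < P" "b ^ 2 < P" "P dvd u * a - v * b"
proof -
  define m where "m = floor_sqrt (nat P)"
  have m: "m ^ 2 \<le> nat P" "nat P < (Suc m) ^ 2"
    unfolding m_def by (simp_all add: Suc_floor_sqrt_power2_gt)
  have m': "int m ^ 2 < P"
  proof -
    have "int m ^ 2 \<le> P"
      using m(1) assms(1) by (metis int_nat_eq less_imp_le of_nat_le_iff of_nat_power)
    then show ?thesis using assms(2)[of "int m"] by linarith
  qed
  define h where "h = (\<lambda>(x, y). (u * int x - v * int y) mod P)"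
  have "h ` ({..m} \<times> {..m}) \<subseteq> {0..<P}"
    using assms(1) by (auto simp: h_def)
  then have "card (h ` ({..m} \<times> {..m})) \<le> card {0..<P}"
    by (intro card_mono) auto
  also have "\<dots> < card ({..m} \<times> {..m})"
    using m(2) by (simp add: card_cartesian_product power2_eq_square)
  finally have "\<not> inj_on h ({..m} \<times> {..m})"
    by (rule pigeonhole)
  then obtain x y x' y' where xy: "x \<le> m" "y \<le> m" "x' \<le> m" "y' \<le> m"
      "(x, y) \<noteq> (x', y')" "h (x, y) = h (x', y')"
    unfolding inj_on_def by auto
  have bd: "(int i - int j) ^ 2 < P" if "i \<le> m" "j \<le> m" for i j
  proof -
    have "\<bar>int i - int j\<bar> \<le> \<bar>int m\<bar>" using that by linarith
    then have "(int i - int j) ^ 2 \<le> int m ^ 2" by (simp only: abs_le_square_iff)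
    then show ?thesis using m' by linarith
  qed
  show ?thesis
  proof (rule that)
    show "(int x - int x', int y - int y') \<noteq> (0, 0)" using xy(5) by auto
    show "(int x - int x') ^ 2 < P" "(int y - int y') ^ 2 < P" using bd xy by auto
    have "P dvd (u * int x - v * int y) - (u * int x' - v * int y')"
      using xy(6) unfolding h_def by (simp add: mod_eq_dvd_iff)
    then show "P dvd u * (int x - int x') - v * (int y - int y')"
      by (simp add: algebra_simps)
  qed
qed

text \<open>
  In the next lemmas \<open>p + q \<surd>-3\<close> is divided by a factor \<open>a + b \<surd>-3\<close> of prime norm \<open>P\<close>; the condition
  \<open>P dvd p * b - q * a\<close> picks out this factor among it and its conjugate.
\<close>

lemma prime_eq_square_plus_three_square:
  fixes P p q :: int
  assumes P: "prime P" "odd P" "P \<noteq> 3" and cop: "coprime p q" and dvd: "P dvd p ^ 2 + 3 * q ^ 2"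
  obtains a b where "P = a ^ 2 + 3 * b ^ 2" "P dvd p * b - q * a"
proof -
  have "P \<noteq> m ^ 2" for m :: int
  proof
    assume eq: "P = m ^ 2"
    have "irreducible P" using P(1) by (intro prime_elem_imp_irreducible prime_imp_prime_elem)
    then have "is_unit m" using eq by (metis irreducibleD power2_eq_square)
    then have "is_unit P" using eq by (metis is_unit_mult_iff power2_eq_square)
    then show False using P(1) not_prime_unit by blast
  qed
  then obtain a b where ab: "(a, b) \<noteq> (0, 0)" "a ^ 2 < P" "b ^ 2 < P" "P dvd q * a - p * b"
    using thue_int[of P q p] P(1) by (metis prime_gt_0_int)
  have nq: "\<not> P dvd q"
  proof
    assume "P dvd q"
    with dvd have "P dvd p ^ 2"
      using dvd_add_left_iff[of P "3 * q ^ 2" "p ^ 2"] by (simp add: power2_eq_square)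
    then have "P dvd p" using P(1) prime_dvd_power by blast
    with \<open>P dvd q\<close> cop P(1) show False by (meson coprime_common_divisor not_prime_unit)
  qed
  \<comment> \<open>From \<open>q a = p b\<close> modulo \<open>P\<close> and
    \<open>p^2 = -3 q^2\<close> modulo \<open>P\<close>, the short vector also has norm divisible by
    \<open>P\<close>. By the size bounds the norm is \<open>P k\<close> with
    \<open>0 < k < 4\<close>.\<close>
  have "q ^ 2 * (a ^ 2 + 3 * b ^ 2) = (q * a - p * b) * (q * a + p * b) + b ^ 2 * (p ^ 2 + 3 * q ^ 2)"
    by (simp add: power2_eq_square algebra_simps)
  also have "P dvd \<dots>" using ab(4) dvd by (auto intro!: dvd_add[OF dvd_mult2 dvd_mult])
  finally have "P dvd a ^ 2 + 3 * b ^ 2"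
    using nq P(1) by (metis prime_dvd_mult_iff prime_dvd_power)
  then obtain k where k: "a ^ 2 + 3 * b ^ 2 = P * k" by blast
  have "P > 0" using P(1) by (rule prime_gt_0_int)
  have "a ^ 2 + 3 * b ^ 2 > 0"
    using ab(1) by (metis add_nonneg_pos add_pos_nonneg mult_pos_pos prod.inject zero_le_power2 zero_less_numeral zero_less_power2 mult_nonneg_nonneg zero_le_numeral)
  then have "P * k > 0" using k by simp
  then have "k > 0" using \<open>P > 0\<close> by (simp add: zero_less_mult_iff)
  have "P * k < P * 4" using k ab by linarith
  then have "k < 4" using \<open>P > 0\<close> by simp
  \<comment> \<open>A value \<open>a^2 + 3 b^2\<close> is never 2 modulo 4.\<close>
  have "k \<noteq> 2"
  proof
    assume "k = 2"
    obtain j where j: "P = 2 * j + 1" using P(2) by (elim oddE)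
    have eq: "a ^ 2 + 3 * b ^ 2 = 4 * j + 2" using k \<open>k = 2\<close> j by simp
    then have "even (a ^ 2 + 3 * b ^ 2)" by presburger
    then have "even (a + b)" by (auto simp: even_add even_mult_iff)
    then have "even (a - b)" by auto
    then obtain t where "a = b + 2 * t" by (metis add_diff_cancel_left' dvdE diff_add_cancel add.commute)
    with eq have "4 * (b ^ 2 + b * t + t ^ 2) = 4 * j + 2"
      by (simp add: power2_eq_square algebra_simps)
    then show False by presburger
  qed
  with \<open>k > 0\<close> \<open>k < 4\<close> consider "k = 1" | "k = 3" by linarith
  then show ?thesis
  proof cases
    case 1
    show ?thesis
      by (rule that[of a b]) (use k 1 ab(4) in \<open>auto simp: dvd_diff_commute mult.commute\<close>)
  next
    case 2
    \<comment> \<open>For \<open>k = 3\<close> the factor sqrt(-3) is split off: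
      \<open>a = 3 c\<close> turns the norm equation into \<open>P = b^2 + 3 c^2\<close>. The sign
      in \<open>- c\<close> selects the conjugate that satisfies the divisibility condition.\<close>
    have "a ^ 2 = 3 * (P - b ^ 2)" using k 2 by simp
    then have "3 dvd a ^ 2" by simp
    then have "3 dvd a" using prime_dvd_power[of "3::int" a 2] by simp
    then obtain c where c: "a = 3 * c" by blast
    have "P = b ^ 2 + 3 * (- c) ^ 2" using k 2 c by (simp add: power2_eq_square)
    moreover have "P dvd p * (- c) - q * b"
    proof -
      have "3 * q * (p * (- c) - q * b) = - p * (q * a - p * b) - b * (p ^ 2 + 3 * q ^ 2)"
        using c by (simp add: power2_eq_square algebra_simps)
      also have "P dvd \<dots>" using ab(4) dvd by (auto intro!: dvd_diff[OF dvd_mult dvd_mult])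
      finally have "P dvd 3 * q \<or> P dvd p * (- c) - q * b"
        using P(1) prime_dvd_mult_iff by blast
      moreover have "\<not> P dvd 3"
        using P(1,3) primes_dvd_imp_eq[of P 3] by auto
      ultimately show ?thesis using nq P(1) prime_dvd_mult_iff by blast
    qed
    ultimately show ?thesis by (rule that)
  qed
qed

lemma divide_by_prime_norm:
  fixes P p q a b :: int
  assumes P: "prime P" "P = a ^ 2 + 3 * b ^ 2" and dvd: "P dvd p ^ 2 + 3 * q ^ 2" "P dvd p * b - q * a"
  obtains p' q' where "p = a * p' - 3 * b * q'" "q = b * p' + a * q'"
    "p ^ 2 + 3 * q ^ 2 = P * (p' ^ 2 + 3 * q' ^ 2)"
proof -
  \<comment> \<open>Division means multiplying by the conjugate and dividing by \<open>P\<close>: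
    the coordinates of \<open>(p + q sqrt(-3)) (a - b sqrt(-3))\<close> are
    \<open>p a + 3 q b\<close> and \<open>q a - p b\<close>. Both turn out to be divisible by
    \<open>P\<close>.\<close>
  have "(p * a + 3 * q * b) ^ 2 = (p ^ 2 + 3 * q ^ 2) * P - 3 * (p * b - q * a) * (p * b - q * a)"
    unfolding P(2) by (simp add: power2_eq_square algebra_simps)
  also have "P dvd \<dots>" using dvd by (auto intro!: dvd_diff[OF dvd_mult dvd_mult])
  finally have "P dvd p * a + 3 * q * b" using P(1) prime_dvd_power by blast
  then obtain p' where p': "p * a + 3 * q * b = P * p'" by blast
  obtain t where t: "p * b - q * a = P * t" using dvd(2) by blast
  have "P \<noteq> 0" using P(1) by auto
  have "P * p = P * (a * p' - 3 * b * (- t))"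
  proof -
    have "P * p = a * (p * a + 3 * q * b) + 3 * b * (p * b - q * a)"
      by (subst P(2)) (simp add: power2_eq_square algebra_simps)
    then show ?thesis unfolding p' t by (simp add: algebra_simps)
  qed
  then have 1: "p = a * p' - 3 * b * (- t)" using \<open>P \<noteq> 0\<close> by simp
  have "P * q = P * (b * p' + a * (- t))"
  proof -
    have "P * q = b * (p * a + 3 * q * b) - a * (p * b - q * a)"
      by (subst P(2)) (simp add: power2_eq_square algebra_simps)
    then show ?thesis unfolding p' t by (simp add: algebra_simps)
  qed
  then have 2: "q = b * p' + a * (- t)" using \<open>P \<noteq> 0\<close> by simp
  have "p ^ 2 + 3 * q ^ 2 = P * (p' ^ 2 + 3 * (- t) ^ 2)"
    unfolding 1 2 P(2) by (simp add: power2_eq_square algebra_simps)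
  with 1 2 show ?thesis by (rule that)
qed

text \<open>After one factor \<open>a + b sqrt(-3)\<close> has been removed, the next factor of norm
  \<open>P\<close> cannot be the conjugate: the two together would contribute \<open>P\<close>
  itself, which would then divide both \<open>p\<close> and \<open>q\<close>. Hence the same
  \<open>a\<close> and \<open>b\<close> serve again.\<close>

lemma divide_by_prime_norm_again:
  fixes P p q a b p' q' :: int
  assumes P: "prime P" "P = a ^ 2 + 3 * b ^ 2"
    and eq: "p = a * p' - 3 * b * q'" "q = b * p' + a * q'" and cop: "coprime p q"
    and dvd: "P dvd p' ^ 2 + 3 * q' ^ 2"
  obtains p'' q'' where "p' = a * p'' - 3 * b * q''" "q' = b * p'' + a * q''"
    "p' ^ 2 + 3 * q' ^ 2 = P * (p'' ^ 2 + 3 * q'' ^ 2)"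
proof -
  have "\<not> P dvd q"
  proof
    assume "P dvd q"
    have "p ^ 2 + 3 * q ^ 2 = P * (p' ^ 2 + 3 * q' ^ 2)"
      unfolding eq P(2) by (simp add: power2_eq_square algebra_simps)
    then have "P dvd p ^ 2 + 3 * q ^ 2" by simp
    with \<open>P dvd q\<close> have "P dvd p ^ 2"
      using dvd_add_left_iff[of P "3 * q ^ 2" "p ^ 2"] by (simp add: power2_eq_square)
    then have "P dvd p" using P(1) prime_dvd_power by blast
    with \<open>P dvd q\<close> cop P(1) show False by (meson coprime_common_divisor not_prime_unit)
  qed
  moreover have "(p' * b - q' * a) * q = b ^ 2 * (p' ^ 2 + 3 * q' ^ 2) - q' ^ 2 * P"
    unfolding eq P(2) by (simp add: power2_eq_square algebra_simps)
  then have "P dvd (p' * b - q' * a) * q" using dvd by (metis dvd_diff dvd_mult dvd_refl)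
  ultimately have "P dvd p' * b - q' * a" using P(1) prime_dvd_mult_iff by blast
  then show ?thesis using divide_by_prime_norm[OF P dvd] that by blast
qed

text \<open>The conclusion says \<open>p + q \<surd>-3 = (a + b \<surd>-3)^3\<close>.\<close>

lemma square_plus_three_square_eq_cube:
  fixes p q s :: int
  assumes "coprime p q" "p ^ 2 + 3 * q ^ 2 = s ^ 3" "odd s"
  shows "\<exists>a b. p = a ^ 3 - 9 * a * b ^ 2 \<and> q = 3 * a ^ 2 * b - 3 * b ^ 3"
  using assms
proof (induction "nat s" arbitrary: p q s rule: less_induct)
  case (less s p q)
  have "s ^ 3 \<ge> 0" using less.prems(2) by (metis add_nonneg_nonneg mult_nonneg_nonneg zero_le_numeral zero_le_power2)
  then have "s \<ge> 0" by (simp add: zero_le_power_eq)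
  show ?case
  proof (cases "s = 1")
    case True
    have "q = 0"
    proof (rule ccontr)
      assume "q \<noteq> 0"
      then have "q ^ 2 > 0" by simp
      then have "q ^ 2 \<ge> 1" by linarith
      moreover have "p ^ 2 \<ge> 0" by simp
      moreover have "p ^ 2 + 3 * q ^ 2 = 1" using less.prems(2) True by simp
      ultimately show False by linarith
    qed
    moreover have "p ^ 3 = p" 
    proof -
      have "p ^ 2 = 1" using less.prems(2) True \<open>q = 0\<close> by simp
      then show ?thesis by (simp add: power3_eq_cube power2_eq_square)
    qed
    ultimately show ?thesis by (intro exI[of _ p] exI[of _ 0]) simp
  next
    case False
    have "s \<noteq> 0" using less.prems(3) by auto
    with False \<open>s \<ge> 0\<close> have "s > 1" by linarith
    \<comment> \<open>The factor of norm \<open>P\<close> is removed three times. What remains has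
      norm \<open>s'^3\<close> with \<open>s' < s\<close>, so it is a cube by induction.\<close>
    then obtain P where P: "prime P" "P dvd s"
      using prime_divisor_exists[of s] by (auto simp: zdvd1_eq)
    then obtain s' where s': "s = P * s'" by blast
    have "P > 1" using P(1) by (rule prime_gt_1_int)
    have "s' > 0" using s' \<open>s > 1\<close> \<open>P > 1\<close> by (metis less_trans zero_less_mult_pos zero_less_one)
    have "s' < s" using s' \<open>s' > 0\<close> \<open>P > 1\<close> by simp
    have "odd P" "odd s'" using s' less.prems(3) by auto
    have N: "p ^ 2 + 3 * q ^ 2 = P * (P * (P * s' ^ 3))"
      using less.prems(2) s' by (simp add: power3_eq_cube)
    have "P \<noteq> 3"
    proof
      assume "P = 3"
      then have "p ^ 2 + 3 * q ^ 2 = 27 * s' ^ 3" using N by simp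
      then have "3 dvd p ^ 2" by presburger
      then have "3 dvd p" using prime_dvd_power[of "3::int" p 2] by simp
      then obtain r where "p = 3 * r" by blast
      with \<open>p ^ 2 + 3 * q ^ 2 = 27 * s' ^ 3\<close> have "3 * r ^ 2 + q ^ 2 = 9 * s' ^ 3"
        by (simp add: power2_eq_square)
      then have "3 dvd q ^ 2" by presburger
      then have "3 dvd q" using prime_dvd_power[of "3::int" q 2] by simp
      with \<open>3 dvd p\<close> less.prems(1) show False
        using P(1) \<open>P = 3\<close> by (meson coprime_common_divisor not_prime_unit)
    qed
    have "P dvd p ^ 2 + 3 * q ^ 2" using N by simp
    then obtain a b where ab: "P = a ^ 2 + 3 * b ^ 2" "P dvd p * b - q * a"
      using prime_eq_square_plus_three_square[OF P(1) \<open>odd P\<close> \<open>P \<noteq> 3\<close> less.prems(1)] by blast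
    obtain p1 q1 where 1: "p = a * p1 - 3 * b * q1" "q = b * p1 + a * q1"
        "p ^ 2 + 3 * q ^ 2 = P * (p1 ^ 2 + 3 * q1 ^ 2)"
      using divide_by_prime_norm[OF P(1) ab(1) \<open>P dvd p ^ 2 + 3 * q ^ 2\<close> ab(2)] by blast
    have N1: "p1 ^ 2 + 3 * q1 ^ 2 = P * (P * s' ^ 3)" using N 1(3) \<open>P > 1\<close> by simp
    have cop1: "coprime p1 q1"
    proof (rule coprimeI)
      fix d assume "d dvd p1" "d dvd q1"
      then have "d dvd p" "d dvd q" unfolding 1(1,2) by auto
      then show "is_unit d" using less.prems(1) coprime_common_divisor by blast
    qed
    have "P dvd p1 ^ 2 + 3 * q1 ^ 2" using N1 by simp
    then obtain p2 q2 where 2: "p1 = a * p2 - 3 * b * q2" "q1 = b * p2 + a * q2"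
        "p1 ^ 2 + 3 * q1 ^ 2 = P * (p2 ^ 2 + 3 * q2 ^ 2)"
      using divide_by_prime_norm_again[OF P(1) ab(1) 1(1,2) less.prems(1)] by blast
    have N2: "p2 ^ 2 + 3 * q2 ^ 2 = P * s' ^ 3" using N1 2(3) \<open>P > 1\<close> by simp
    then have "P dvd p2 ^ 2 + 3 * q2 ^ 2" by simp
    then obtain p3 q3 where 3: "p2 = a * p3 - 3 * b * q3" "q2 = b * p3 + a * q3"
        "p2 ^ 2 + 3 * q2 ^ 2 = P * (p3 ^ 2 + 3 * q3 ^ 2)"
      using divide_by_prime_norm_again[OF P(1) ab(1) 2(1,2) cop1] by blast
    have N3: "p3 ^ 2 + 3 * q3 ^ 2 = s' ^ 3" using N2 3(3) \<open>P > 1\<close> by simp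
    have "coprime p3 q3"
    proof (rule coprimeI)
      fix d assume "d dvd p3" "d dvd q3"
      then have "d dvd p2" "d dvd q2" unfolding 3(1,2) by auto
      then have "d dvd p1" "d dvd q1" unfolding 2(1,2) by auto
      then show "is_unit d" using cop1 coprime_common_divisor by blast
    qed
    with N3 \<open>odd s'\<close> obtain x y where
      xy: "p3 = x ^ 3 - 9 * x * y ^ 2" "q3 = 3 * x ^ 2 * y - 3 * y ^ 3"
      using less.hyps[of s' p3 q3] \<open>s' < s\<close> \<open>s > 1\<close> by auto
    \<comment> \<open>Product of the cubes of \<open>a + b sqrt(-3)\<close> and
      \<open>x + y sqrt(-3)\<close>; the new base is the product of the two bases.\<close>
    have "p = (a * x - 3 * b * y) ^ 3 - 9 * (a * x - 3 * b * y) * (a * y + b * x) ^ 2"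
      "q = 3 * (a * x - 3 * b * y) ^ 2 * (a * y + b * x) - 3 * (a * y + b * x) ^ 3"
      unfolding 1 2 3 xy by (simp_all add: power2_eq_square power3_eq_cube algebra_simps)
    then show ?thesis by blast
  qed
qed

lemma coprime_mult_eq_cube:
  fixes m n k :: int
  assumes "coprime m n" "m * n = k ^ 3" "k \<noteq> 0"
  obtains s where "m = s ^ 3"
proof -
  have nz: "m \<noteq> 0" "n \<noteq> 0" using assms by auto
  have "nat \<bar>m\<bar> * nat \<bar>n\<bar> = nat \<bar>k\<bar> ^ 3"
    using assms(2) by (metis abs_mult nat_abs_mult_distrib nat_power_eq abs_ge_zero power_abs)
  then have "is_nth_power 3 (nat \<bar>m\<bar> * nat \<bar>n\<bar>)" by (metis is_nth_power_nth_power)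
  moreover have "coprime (nat \<bar>m\<bar>) (nat \<bar>n\<bar>)"
    using assms(1) by (metis abs_ge_zero coprime_abs_left_iff coprime_abs_right_iff coprime_int_iff int_nat_eq)
  ultimately have "is_nth_power 3 (nat \<bar>m\<bar>)"
    using is_nth_power_mult_coprime_natD(1) nz by (metis zero_less_abs_iff zero_less_nat_eq)
  then obtain t where "nat \<bar>m\<bar> = t ^ 3" by (elim is_nth_powerE)
  then have t: "\<bar>m\<bar> = int t ^ 3" by (metis abs_ge_zero int_nat_eq of_nat_power)
  show ?thesis
  proof (cases "m \<ge> 0")
    case True
    then show ?thesis using t that by auto
  next
    case False
    then have "m = (- int t) ^ 3" using t by simp
    then show ?thesis using that by blast
  qed
qed

subsection \<open>Descent for x y (x + y) = 4 z^3\<close>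

lemma cube_descent_bound:
  fixes c A N :: int
  assumes "A ^ 3 * N = c ^ 3" "N > 1" "c \<noteq> 0"
  shows "\<bar>A\<bar> < \<bar>c\<bar>"
proof (rule ccontr)
  assume "\<not> \<bar>A\<bar> < \<bar>c\<bar>"
  then have "\<bar>c\<bar> ^ 3 \<le> \<bar>A\<bar> ^ 3" by (intro power_mono) auto
  have "\<bar>c\<bar> ^ 3 = \<bar>A\<bar> ^ 3 * N"
    using assms(1,2) by (metis abs_mult abs_of_pos less_trans power_abs zero_less_one)
  have "A \<noteq> 0" using assms by auto
  then have "\<bar>A\<bar> ^ 3 * 1 < \<bar>A\<bar> ^ 3 * N"
    using assms(2) by (intro mult_strict_left_mono) auto
  with \<open>\<bar>c\<bar> ^ 3 = \<bar>A\<bar> ^ 3 * N\<close> \<open>\<bar>c\<bar> ^ 3 \<le> \<bar>A\<bar> ^ 3\<close> show False by linarith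
qed

text \<open>The numbers \<open>x\<close>, \<open>y\<close>, \<open>x + y\<close> are pairwise
  coprime and only \<open>x\<close> is even, so \<open>x / 4\<close>, \<open>y\<close>,
  \<open>x + y\<close> are cubes \<open>s^3\<close>, \<open>t^3\<close>, \<open>r^3\<close>. Then
  \<open>r^3 - t^3 = x = 4 s^3\<close>.\<close>

lemma sum_of_cubes_from_product:
  fixes x y z :: int
  assumes cop: "coprime x y" and eq: "x * y * (x + y) = 4 * z ^ 3" and nz: "z \<noteq> 0" and ev: "even x"
  obtains a b c where "odd a" "odd b" "coprime a b" "a ^ 3 + b ^ 3 = 4 * c ^ 3" "c \<noteq> 0" "\<bar>c\<bar> \<le> \<bar>z\<bar>"
proof -
  have "odd y" using cop ev by (meson coprime_common_divisor odd_one)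
  have cop': "coprime x (x + y)" "coprime y (x + y)"
    using cop by (metis add.commute coprime_commute coprime_iff_gcd_eq_1 gcd_add2)+
  have "coprime 4 (y * (x + y))"
  proof -
    have "odd (y * (x + y))" using \<open>odd y\<close> ev by simp
    then have "coprime (2 ^ 2) (y * (x + y))" by (simp only: coprime_power_left_iff coprime_left_2_iff_odd) simp
    then show ?thesis by simp
  qed
  moreover have "4 dvd x * (y * (x + y))" using eq by (simp add: mult.assoc)
  ultimately have "4 dvd x" by (simp add: coprime_dvd_mult_left_iff)
  then obtain x' where x': "x = 4 * x'" by blast
  have eq': "x' * (y * (x + y)) = z ^ 3" using eq unfolding x' by simp
  have cx: "coprime x' y" "coprime x' (x + y)" using cop cop'(1) x' by simp_all
  have "coprime x' (y * (x + y))" using cx by simp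
  then obtain s where s: "x' = s ^ 3" using coprime_mult_eq_cube[OF _ eq' nz] by blast
  have "coprime y (x' * (x + y))" using cx(1) cop'(2) by (simp add: coprime_commute)
  moreover have "y * (x' * (x + y)) = z ^ 3" using eq' by (simp add: mult_ac)
  ultimately obtain t where t: "y = t ^ 3" using coprime_mult_eq_cube nz by blast
  have "coprime (x + y) (x' * y)" using cx(2) cop'(2) by (simp add: coprime_commute)
  moreover have "(x + y) * (x' * y) = z ^ 3" using eq' by (simp add: mult_ac)
  ultimately obtain r where r: "x + y = r ^ 3" using coprime_mult_eq_cube nz by blast
  show ?thesis
  proof (rule that[of r "- t" s])
    show "odd r" using r \<open>odd y\<close> ev by (metis even_add even_power zero_less_numeral)
    show "odd (- t)" using t \<open>odd y\<close> by auto
    have "coprime y (r ^ 3)" using cop'(2) unfolding r .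
    then show "coprime r (- t)" unfolding t by (simp add: coprime_commute)
    show "r ^ 3 + (- t) ^ 3 = 4 * s ^ 3" using r t s x' by simp
    show "s \<noteq> 0" using s eq' nz by auto
    have "s ^ 3 dvd z ^ 3" using eq' s by (metis dvd_triv_left)
    then have "s dvd z" by simp
    then show "\<bar>s\<bar> \<le> \<bar>z\<bar>" using nz by (rule dvd_imp_le_int[rotated])
  qed
qed

lemma coprime_of_primes_int:
  fixes u v :: int
  assumes "\<And>r. prime r \<Longrightarrow> r dvd u \<Longrightarrow> r dvd v \<Longrightarrow> False" "u \<noteq> 0"
  shows "coprime u v"
proof (rule coprimeI)
  fix d assume d: "d dvd u" "d dvd v"
  show "is_unit d"
  proof (rule ccontr)
    assume "\<not> is_unit d"
    moreover have "d \<noteq> 0" using d(1) assms(2) by auto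
    ultimately obtain r where "prime r" "r dvd d" using prime_divisor_exists[of d] by auto
    then show False using assms(1) d dvd_trans by blast
  qed
qed

lemma odd_square_plus_three_square:
  fixes p q :: int
  assumes "odd (p + q)"
  shows "odd (p ^ 2 + 3 * q ^ 2)"
  using assms by (auto simp: even_add even_mult_iff)

text \<open>Writing \<open>a = p + q\<close> and \<open>b = p - q\<close> gives
  \<open>p (p^2 + 3 q^2) = 2 c^3\<close>. Up to the primes 2 and 3 both factors are cubes, so an
  element of norm the second factor is a cube \<open>(\<alpha> + \<beta> sqrt(-3))^3\<close>. Its
  coordinates split into linear factors, from which the smaller solution is read off.\<close>

lemma cube_descent_step:
  fixes a b c :: int
  assumes "odd a" "odd b" "coprime a b" "a ^ 3 + b ^ 3 = 4 * c ^ 3" "c \<noteq> 0"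
  obtains u v w where "coprime u v" "u * v * (u + v) = 4 * w ^ 3" "w \<noteq> 0" "\<bar>w\<bar> < \<bar>c\<bar>"
proof -
  obtain p where p: "a + b = 2 * p" using assms(1,2) by (meson dvdE odd_even_add)
  define q where "q = a - p"
  have ab: "a = p + q" "b = p - q" using p by (auto simp: q_def)
  have cop: "coprime p q"
  proof (rule coprimeI)
    fix d assume "d dvd p" "d dvd q"
    then have "d dvd a" "d dvd b" unfolding ab by auto
    then show "is_unit d" using assms(3) coprime_common_divisor by blast
  qed
  define N where "N = p ^ 2 + 3 * q ^ 2"
  have "2 * (p * N) = a ^ 3 + b ^ 3"
    unfolding ab N_def by (simp add: power2_eq_square power3_eq_cube algebra_simps)
  then have pN: "p * N = 2 * c ^ 3" using assms(4) by linarith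
  have "odd N" unfolding N_def using assms(1) ab(1) by (intro odd_square_plus_three_square) simp
  have "p \<noteq> 0" using pN assms(5) by auto
  have "even (p * N)" using pN by simp
  then have "even p" using \<open>odd N\<close> by simp
  then have "odd q" using assms(1) ab by simp
  then have "q \<noteq> 0" by auto
  then have "q ^ 2 \<ge> 1" by (simp add: int_one_le_iff_zero_less)
  have "p ^ 2 \<ge> 1" using \<open>p \<noteq> 0\<close> by (simp add: int_one_le_iff_zero_less)
  show ?thesis
  proof (cases "3 dvd p")
    case False
    obtain p' where p': "p = 2 * p'" using \<open>even p\<close> by blast
    have eq: "p' * N = c ^ 3" using pN p' by simp
    have "coprime p N"
    proof (rule coprime_of_primes_int[OF _ \<open>p \<noteq> 0\<close>])
      fix r :: int assume r: "prime r" "r dvd p" "r dvd N"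
      have "r dvd p ^ 2" using r(2) by (simp add: power2_eq_square)
      then have "r dvd 3 * q ^ 2" using r(3) unfolding N_def by (metis dvd_add_right_iff)
      then have "r dvd 3 \<or> r dvd q" using r(1) by (metis prime_dvd_mult_iff prime_dvd_power)
      moreover have "\<not> r dvd q" using cop r(1,2) by (meson coprime_common_divisor not_prime_unit)
      ultimately have "r = 3" using primes_dvd_imp_eq[of r 3] r(1) by simp
      with r(2) False show False by simp
    qed
    then have "coprime p' N" using p' by simp
    obtain A where A: "p' = A ^ 3" using coprime_mult_eq_cube[OF \<open>coprime p' N\<close> eq assms(5)] by blast
    have "coprime N p'" "N * p' = c ^ 3" using \<open>coprime p' N\<close> eq by (simp_all add: ac_simps)
    then obtain B where B: "N = B ^ 3" using coprime_mult_eq_cube assms(5) by blast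
    have "odd B" using \<open>odd N\<close> B by simp
    then obtain \<alpha> \<beta> where \<alpha>\<beta>: "p = \<alpha> ^ 3 - 9 * \<alpha> * \<beta> ^ 2" "q = 3 * \<alpha> ^ 2 * \<beta> - 3 * \<beta> ^ 3"
      using square_plus_three_square_eq_cube[OF cop B[unfolded N_def]] by blast
    have fac: "p = \<alpha> * (\<alpha> ^ 2 - 9 * \<beta> ^ 2)" "q = \<beta> * (3 * \<alpha> ^ 2 - 3 * \<beta> ^ 2)"
      unfolding \<alpha>\<beta> by (simp_all add: power2_eq_square power3_eq_cube algebra_simps)
    have "\<alpha> dvd p" "\<beta> dvd q" by (simp_all add: fac)
    have odd: "odd (\<alpha> - 3 * \<beta>)" using \<open>odd q\<close> unfolding fac by auto
    show ?thesis
    \<comment> \<open>Here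
      \<open>p = \<alpha> (\<alpha> - 3 \<beta>) (\<alpha> + 3 \<beta>)\<close>, and the last two
      factors add up to \<open>2 \<alpha>\<close>. Hence their product times their sum is
      \<open>2 p = 4 A^3\<close>.\<close>
    proof (rule that[of "\<alpha> - 3 * \<beta>" "\<alpha> + 3 * \<beta>" A])
      show "coprime (\<alpha> - 3 * \<beta>) (\<alpha> + 3 * \<beta>)"
      proof (rule coprime_of_primes_int)
        show "\<alpha> - 3 * \<beta> \<noteq> 0" using odd by auto
        fix r :: int assume r: "prime r" "r dvd \<alpha> - 3 * \<beta>" "r dvd \<alpha> + 3 * \<beta>"
        have "\<not> r dvd 2" using primes_dvd_imp_eq[of r 2] r odd by auto
        moreover have "r dvd 2 * \<alpha>" using dvd_add[OF r(2,3)] by simp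
        ultimately have "r dvd \<alpha>" using r(1) prime_dvd_mult_iff by blast
        then have "r dvd p" using \<open>\<alpha> dvd p\<close> dvd_trans by blast
        have "r dvd 3 * \<beta>" using r(3) \<open>r dvd \<alpha>\<close> by (simp add: dvd_add_right_iff)
        then have "r dvd 3 \<or> r dvd \<beta>" using r(1) prime_dvd_mult_iff by blast
        moreover have "\<not> r dvd 3" using primes_dvd_imp_eq[of r 3] r(1) \<open>r dvd p\<close> False by auto
        ultimately have "r dvd q" using \<open>\<beta> dvd q\<close> dvd_trans by blast
        with \<open>r dvd p\<close> show False using cop r(1) by (meson coprime_common_divisor not_prime_unit)
      qed
      have "(\<alpha> - 3 * \<beta>) * (\<alpha> + 3 * \<beta>) * (\<alpha> - 3 * \<beta> + (\<alpha> + 3 * \<beta>)) = 2 * p"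
        unfolding fac by (simp add: power2_eq_square algebra_simps)
      then show "(\<alpha> - 3 * \<beta>) * (\<alpha> + 3 * \<beta>) * (\<alpha> - 3 * \<beta> + (\<alpha> + 3 * \<beta>)) = 4 * A ^ 3"
        using p' A by simp
      show "A \<noteq> 0" using A p' \<open>p \<noteq> 0\<close> by auto
      show "\<bar>A\<bar> < \<bar>c\<bar>"
      proof (rule cube_descent_bound)
        show "A ^ 3 * N = c ^ 3" using eq A by simp
        show "N > 1" using \<open>p ^ 2 \<ge> 1\<close> \<open>q ^ 2 \<ge> 1\<close> unfolding N_def by linarith
      qed fact
    qed
  next
    case True
    then obtain p0 where p0: "p = 3 * p0" by blast
    \<comment> \<open>Now \<open>p\<close> and \<open>N\<close> share the factor 3. Dividing
      \<open>p + q sqrt(-3)\<close> by sqrt(-3) leaves, up to conjugation and sign,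
      \<open>q + p0 sqrt(-3)\<close> of norm \<open>M\<close>, and the roles of the two coordinates
      are exchanged.\<close>
    define M where "M = q ^ 2 + 3 * p0 ^ 2"
    have NM: "N = 3 * M" unfolding N_def M_def p0 by (simp add: power2_eq_square)
    have "9 * (p0 * M) = 2 * c ^ 3" using pN unfolding NM p0 by simp
    then have "3 dvd c ^ 3" by presburger
    then have "3 dvd c" using prime_dvd_power[of "3::int" c 3] by simp
    then obtain c' where c': "c = 3 * c'" by blast
    have "c ^ 3 = 27 * c' ^ 3" unfolding c' by (simp add: power_mult_distrib)
    with \<open>9 * (p0 * M) = 2 * c ^ 3\<close> have p0M: "p0 * M = 6 * c' ^ 3" by linarith
    have "odd M" using \<open>odd N\<close> NM by simp
    have "\<not> 3 dvd q"
    proof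
      assume "3 dvd q"
      then have "is_unit (3 :: int)" using True cop coprime_common_divisor by blast
      then show False by simp
    qed
    have "\<not> 3 dvd M"
    proof
      assume "3 dvd M"
      then have "3 dvd q ^ 2" unfolding M_def by presburger
      then show False using prime_dvd_power[of "3::int" q 2] \<open>\<not> 3 dvd q\<close> by simp
    qed
    have "3 dvd p0 * M" "2 dvd p0 * M" using p0M by simp_all
    then have "3 dvd p0" "2 dvd p0"
      using \<open>odd M\<close> \<open>\<not> 3 dvd M\<close> prime_dvd_mult_iff[of "3::int"] by auto
    then have "6 dvd p0" by presburger
    then obtain p' where p': "p0 = 6 * p'" by blast
    have eq: "p' * M = c' ^ 3" using p0M p' by simp
    have "c' \<noteq> 0" using assms(5) c' by simp
    have "p0 \<noteq> 0" using \<open>p \<noteq> 0\<close> p0 by simp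
    then have "p0 ^ 2 \<ge> 1" by (simp add: int_one_le_iff_zero_less)
    have cop0: "coprime q p0" using cop p0 by (simp add: coprime_commute)
    have "coprime p0 M"
    proof (rule coprime_of_primes_int[OF _ \<open>p0 \<noteq> 0\<close>])
      fix r :: int assume r: "prime r" "r dvd p0" "r dvd M"
      have "r dvd 3 * p0 ^ 2" using r(2) by (simp add: power2_eq_square)
      then have "r dvd q ^ 2" using r(3) unfolding M_def by (metis dvd_add_left_iff)
      then have "r dvd q" using r(1) prime_dvd_power by blast
      then show False using cop0 r(1,2) by (meson coprime_common_divisor not_prime_unit)
    qed
    then have "coprime p' M" using p' by simp
    obtain A where A: "p' = A ^ 3" using coprime_mult_eq_cube[OF \<open>coprime p' M\<close> eq \<open>c' \<noteq> 0\<close>] by blast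
    have "coprime M p'" "M * p' = c' ^ 3" using \<open>coprime p' M\<close> eq by (simp_all add: ac_simps)
    then obtain B where B: "M = B ^ 3" using coprime_mult_eq_cube \<open>c' \<noteq> 0\<close> by blast
    have "odd B" using \<open>odd M\<close> B by simp
    then obtain \<alpha> \<beta> where \<alpha>\<beta>: "q = \<alpha> ^ 3 - 9 * \<alpha> * \<beta> ^ 2" "p0 = 3 * \<alpha> ^ 2 * \<beta> - 3 * \<beta> ^ 3"
      using square_plus_three_square_eq_cube[OF cop0 B[unfolded M_def]] by blast
    have fac: "q = \<alpha> * (\<alpha> ^ 2 - 9 * \<beta> ^ 2)" "p0 = \<beta> * (3 * \<alpha> ^ 2 - 3 * \<beta> ^ 2)"
      unfolding \<alpha>\<beta> by (simp_all add: power2_eq_square power3_eq_cube algebra_simps)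
    have "\<alpha> dvd q" "\<beta> dvd p0" by (simp_all add: fac)
    have odd: "odd (\<alpha> + \<beta>)" using \<open>odd q\<close> unfolding fac by auto
    show ?thesis
    \<comment> \<open>Here \<open>p0 = 3 \<beta> (\<alpha> - \<beta>) (\<alpha> + \<beta>)\<close>,
      and the chosen numbers add up to \<open>2 \<beta>\<close>; the sign of \<open>- A\<close>
      comes from reversing \<open>\<alpha> - \<beta>\<close>.\<close>
    proof (rule that[of "\<alpha> + \<beta>" "\<beta> - \<alpha>" "- A"])
      show "coprime (\<alpha> + \<beta>) (\<beta> - \<alpha>)"
      proof (rule coprime_of_primes_int)
        show "\<alpha> + \<beta> \<noteq> 0" using odd by (metis dvd_0_right)
        fix r :: int assume r: "prime r" "r dvd \<alpha> + \<beta>" "r dvd \<beta> - \<alpha>"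
        have "\<not> r dvd 2" using primes_dvd_imp_eq[of r 2] r odd by auto
        moreover have "r dvd 2 * \<beta>" using dvd_add[OF r(2,3)] by simp
        ultimately have "r dvd \<beta>" using r(1) prime_dvd_mult_iff by blast
        then have "r dvd \<alpha>" using r(2) by (simp add: dvd_add_left_iff)
        with \<open>r dvd \<beta>\<close> have "r dvd q" "r dvd p0" using \<open>\<alpha> dvd q\<close> \<open>\<beta> dvd p0\<close> dvd_trans by blast+
        then show False using cop0 r(1) by (meson coprime_common_divisor not_prime_unit)
      qed
      have "3 * ((\<alpha> + \<beta>) * (\<beta> - \<alpha>) * (\<alpha> + \<beta> + (\<beta> - \<alpha>))) = - 2 * p0"
        unfolding fac by (simp add: power2_eq_square algebra_simps)
      also have "\<dots> = 3 * (4 * (- A) ^ 3)" using p' A by simp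
      finally show "(\<alpha> + \<beta>) * (\<beta> - \<alpha>) * (\<alpha> + \<beta> + (\<beta> - \<alpha>)) = 4 * (- A) ^ 3"
        by (metis mult_left_cancel zero_neq_numeral)
      show "- A \<noteq> 0"
      proof
        assume "- A = 0"
        then have "A = 0" by simp
        then show False using A p' \<open>p0 \<noteq> 0\<close> by simp
      qed
      have "\<bar>A\<bar> < \<bar>c'\<bar>"
      proof (rule cube_descent_bound)
        show "A ^ 3 * M = c' ^ 3" using eq A by simp
        show "M > 1" using \<open>p0 ^ 2 \<ge> 1\<close> \<open>q ^ 2 \<ge> 1\<close> unfolding M_def by linarith
      qed fact
      then show "\<bar>- A\<bar> < \<bar>c\<bar>" unfolding c' by simp
    qed
  qed
qed

text \<open>Infinite descent on \<open>\<bar>z\<bar>\<close>. Once the even one among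
  \<open>x\<close>, \<open>y\<close>, \<open>x + y\<close> is moved to the first place, the two
  preceding lemmas lead to another coprime solution with strictly smaller
  \<open>\<bar>w\<bar>\<close>.\<close>

lemma coprime_product_neq_four_cubes:
  fixes x y z :: int
  assumes "coprime x y" "z \<noteq> 0"
  shows "x * y * (x + y) \<noteq> 4 * z ^ 3"
  using assms
proof (induction "nat \<bar>z\<bar>" arbitrary: x y z rule: less_induct)
  case (less z x y)
  show ?case
  proof
    assume eq: "x * y * (x + y) = 4 * z ^ 3"
    obtain X Y where XY: "coprime X Y" "X * Y * (X + Y) = 4 * z ^ 3" "even X"
    proof -
      consider "even x" | "even y" | "even (x + y)" by auto
      then show ?thesis
      proof cases
        case 1
        then show ?thesis using that less.prems eq by blast
      next
        case 2
        then show ?thesis using that[of y x] less.prems eq by (simp add: ac_simps)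
      next
        case 3
        \<comment> \<open>The equation is invariant under \<open>(x, y) \<mapsto> (- (x + y), x)\<close>.\<close>
        have "coprime (- (x + y)) x"
          using less.prems(1) by (metis coprime_commute coprime_iff_gcd_eq_1 coprime_minus_left_iff gcd_add2)
        moreover have "- (x + y) * x * (- (x + y) + x) = 4 * z ^ 3"
          using eq by (simp add: algebra_simps)
        ultimately show ?thesis using that 3 by (metis even_minus)
      qed
    qed
    from sum_of_cubes_from_product[OF XY(1,2) less.prems(2) XY(3)]
    obtain a b c where abc: "odd a" "odd b" "coprime a b" "a ^ 3 + b ^ 3 = 4 * c ^ 3" "c \<noteq> 0" "\<bar>c\<bar> \<le> \<bar>z\<bar>"
      by blast
    from cube_descent_step[OF abc(1-5)]
    obtain u v w where uvw: "coprime u v" "u * v * (u + v) = 4 * w ^ 3" "w \<noteq> 0" "\<bar>w\<bar> < \<bar>c\<bar>"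
      by blast
    show False using less.hyps[of w u v] uvw abc(6) less.prems(2) by auto
  qed
qed

text \<open>By homogeneity, scaling by \<open>v / y\<close> replaces \<open>(x, y)\<close> by the
  coprime integers \<open>(u, v)\<close> and 4 by \<open>4 (a / b)^3\<close>. Since
  \<open>a / b\<close> is in lowest terms, \<open>b^3\<close> divides 4, so \<open>b = 1\<close> and
  the integer result applies.\<close>

lemma Rats_product_neq_four:
  fixes x y :: "'a :: field_char_0"
  assumes "x \<in> \<rat>" "y \<in> \<rat>"
  shows "x * y * (x + y) \<noteq> 4"
proof
  assume eq: "x * y * (x + y) = 4"
  then have nz: "x \<noteq> 0" "y \<noteq> 0" by auto
  obtain u v where uv: "v > 0" "coprime u v" "x / y = of_int u / of_int v"
    using Rats_cases'[of "x / y"] assms Rats_divide by metis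
  have "of_int v / y \<in> \<rat>" using assms by (intro Rats_divide) auto
  then obtain a b where ab: "b > 0" "coprime a b" "of_int v / y = of_int a / (of_int b :: 'a)"
    using Rats_cases' by metis
  define V :: 'a where "V = of_int v"
  have V: "V \<noteq> 0" using uv(1) by (simp add: V_def)
  have U: "of_int u = V * x / y" using uv(3) nz V by (simp add: V_def[symmetric] field_simps)
  have "of_int (u * v * (u + v)) = (V / y) ^ 3 * (x * y * (x + y))"
    using nz V by (simp add: U V_def[symmetric] field_simps power3_eq_cube)
  also have "V / y = of_int a / of_int b" using ab(3) by (simp add: V_def)
  finally have "of_int (u * v * (u + v)) = (of_int a / of_int b) ^ 3 * (4 :: 'a)" unfolding eq .
  then have "of_int (u * v * (u + v)) * (of_int b) ^ 3 = 4 * (of_int a :: 'a) ^ 3"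
    using ab(1) by (simp add: power_divide)
  then have "of_int (u * v * (u + v) * b ^ 3) = (of_int (4 * a ^ 3) :: 'a)" by simp
  then have int: "u * v * (u + v) * b ^ 3 = 4 * a ^ 3" by (simp only: of_int_eq_iff)
  then have "b ^ 3 dvd 4 * a ^ 3" by (metis dvd_triv_right)
  moreover have "coprime (b ^ 3) (a ^ 3)" using ab(2) by (simp add: coprime_commute)
  ultimately have "b ^ 3 dvd 4" by (simp add: coprime_dvd_mult_left_iff)
  then have "b ^ 3 \<le> 4" by (rule zdvd_imp_le) simp
  have "b = 1"
  proof (rule ccontr)
    assume "b \<noteq> 1"
    then have "2 ^ 3 \<le> b ^ 3" using ab(1) by (intro power_mono) auto
    with \<open>b ^ 3 \<le> 4\<close> show False by simp
  qed
  have "a \<noteq> 0" using ab V nz by (auto simp: V_def[symmetric])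
  with int \<open>b = 1\<close> coprime_product_neq_four_cubes[OF uv(2)] show False by simp
qed

subsection \<open>Multipliers and the normal form z^d + c\<close>

lemma period_atI:
  assumes "(h ^^ n) z = z" "n \<ge> 1" "\<And>m. 1 \<le> m \<Longrightarrow> m < n \<Longrightarrow> (h ^^ m) z \<noteq> z"
  shows "period_at h z = n"
  unfolding period_at_def by (rule Least_equality) (use assms not_less in auto)

text \<open>The affine map conjugates all iterates at once, so periods agree, and its slope cancels
  in the chain rule.\<close>

lemma multiplier_affine_conj:
  fixes f g :: "complex \<Rightarrow> complex"
  assumes conj: "(\<lambda>z. a * z + b) \<circ> f = g \<circ> (\<lambda>z. a * z + b)" and a: "a \<noteq> 0"
    and g: "\<And>z. g field_differentiable at z"
  shows "periodic_point f z \<longleftrightarrow> periodic_point g (a * z + b)"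
    and "multiplier f z = multiplier g (a * z + b)"
proof -
  have iter: "(g ^^ n) (a * x + b) = a * (f ^^ n) x + b" for n x
  proof (induction n)
    case (Suc n)
    then show ?case using fun_cong[OF conj, of "(f ^^ n) x"] by simp
  qed simp
  have per: "(g ^^ n) (a * z + b) = a * z + b \<longleftrightarrow> (f ^^ n) z = z" for n
    unfolding iter using a by simp
  show "periodic_point f z \<longleftrightarrow> periodic_point g (a * z + b)"
    unfolding periodic_point_def per ..
  have period: "period_at g (a * z + b) = period_at f z"
    unfolding period_at_def per ..
  define n where "n = period_at f z"
  have "(g ^^ n) field_differentiable at x" for x
  proof (induction n arbitrary: x)
    case 0
    then show ?case by (simp add: id_def)
  next
    case (Suc n)
    then show ?case using field_differentiable_compose[OF Suc g] by (simp add: o_def)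
  qed
  then have "((g ^^ n) has_field_derivative deriv (g ^^ n) (a * z + b)) (at (a * z + b))"
    by (simp add: DERIV_deriv_iff_field_differentiable)
  then have "((\<lambda>x. ((g ^^ n) (a * x + b) - b) / a) has_field_derivative
      deriv (g ^^ n) (a * z + b)) (at z)"
    using a by (auto intro!: derivative_eq_intros DERIV_chain2[where f = "g ^^ n"])
  moreover have "(\<lambda>x. ((g ^^ n) (a * x + b) - b) / a) = f ^^ n"
    using a by (simp add: iter fun_eq_iff)
  ultimately show "multiplier f z = multiplier g (a * z + b)"
    unfolding multiplier_def period n_def[symmetric] by (simp add: DERIV_imp_deriv)
qed

lemma multiplier_power_plus_const:
  fixes c z :: complex and d :: nat
  defines "g \<equiv> \<lambda>z. z ^ d + c"
  assumes "(g ^^ n) z = z" "n \<ge> 1" "\<And>m. 1 \<le> m \<Longrightarrow> m < n \<Longrightarrow> (g ^^ m) z \<noteq> z"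
  shows "periodic_point g z" "multiplier g z = (\<Prod>i<n. of_nat d * (g ^^ i) z ^ (d - 1))"
proof -
  show "periodic_point g z" unfolding periodic_point_def using assms by blast
  have "((g ^^ k) has_field_derivative (\<Prod>i<k. of_nat d * (g ^^ i) z ^ (d - 1))) (at z)" for k
  proof (induction k)
    case 0
    then show ?case by (simp add: id_def)
  next
    case (Suc k)
    have "(g has_field_derivative of_nat d * (g ^^ k) z ^ (d - 1)) (at ((g ^^ k) z))"
      unfolding g_def by (auto intro!: derivative_eq_intros)
    from DERIV_chain[OF this Suc] show ?case by (simp add: mult.commute o_def)
  qed
  moreover have "period_at g z = n" using assms by (intro period_atI)
  ultimately show "multiplier g z = (\<Prod>i<n. of_nat d * (g ^^ i) z ^ (d - 1))"
    unfolding multiplier_def by (simp add: DERIV_imp_deriv)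
qed

text \<open>The derivative splits over the complex numbers and has a single root \<open>w\<close>,
  so it is \<open>k (z - w)^(d - 1)\<close>. Integration gives
  \<open>f = a (z - w)^d + b\<close>.\<close>

lemma unicritical_normal_form:
  assumes "unicritical f"
  obtains a b c where "a \<noteq> 0"
    "(\<lambda>z. a * z + b) \<circ> poly f = (\<lambda>z. z ^ degree f + c) \<circ> (\<lambda>z. a * z + b)"
proof -
  define d where "d = degree f"
  have d: "d \<ge> 2" using assms by (simp add: unicritical_def d_def)
  obtain w where w: "poly (pderiv f) w = 0" "\<And>x. poly (pderiv f) x = 0 \<Longrightarrow> x = w"
    using assms unfolding unicritical_def by blast
  have deg: "degree (pderiv f) = d - 1" by (simp add: degree_pderiv d_def)
  then have nz: "pderiv f \<noteq> 0" using d by auto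
  obtain A where A: "size A = d - 1" 
      "pderiv f = smult (lead_coeff (pderiv f)) (\<Prod>x\<in>#A. [:- x, 1:])"
    using alg_closed_imp_factorization[OF nz] deg by auto
  define k where "k = lead_coeff (pderiv f)"
  have "x = w" if x: "x \<in># A" for x
  proof (rule w(2))
    obtain A' where "A = add_mset x A'" using multi_member_split[OF x] by blast
    then show "poly (pderiv f) x = 0" by (subst A(2)) simp
  qed
  then have "A = replicate_mset (d - 1) w"
    using A(1) by (metis set_mset_subset_singletonD subsetI singletonI)
  then have pd: "pderiv f = smult k ([:- w, 1:] ^ (d - 1))"
    using A(2) by (simp add: k_def)
  define a where "a = k / of_nat d"
  have "pderiv (smult a ([:- w, 1:] ^ d)) = smult k ([:- w, 1:] ^ (d - 1))"
    using d by (simp add: pderiv_smult pderiv_power pderiv_pCons a_def)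
  then have "pderiv (f - smult a ([:- w, 1:] ^ d)) = 0" using pd by (simp add: pderiv_diff)
  then have "degree (f - smult a ([:- w, 1:] ^ d)) = 0" by (simp add: pderiv_eq_0_iff)
  then obtain b where "f - smult a ([:- w, 1:] ^ d) = [:b:]" by (rule degree_eq_zeroE)
  then have "f = smult a ([:- w, 1:] ^ d) + [:b:]" by (simp add: diff_eq_eq)
  then have f: "poly f z = a * (z - w) ^ d + b" for z by (simp add: poly_power)
  have "k \<noteq> 0" using nz by (simp add: k_def)
  then have "a \<noteq> 0" using d by (simp add: a_def)
  \<comment> \<open>Conjugation by \<open>\<alpha> (z - w)\<close> makes the polynomial monic
    exactly when \<open>\<alpha> a = \<alpha>^d\<close>.\<close>
  obtain \<alpha> where \<alpha>: "\<alpha> ^ (d - 1) = a" using nth_root_exists[of "d - 1" a] d by auto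
  have "\<alpha> \<noteq> 0" using \<alpha> \<open>a \<noteq> 0\<close> d by (auto simp: power_0_left)
  moreover have "(\<lambda>z. \<alpha> * z + - \<alpha> * w) \<circ> poly f =
      (\<lambda>z. z ^ degree f + \<alpha> * (b - w)) \<circ> (\<lambda>z. \<alpha> * z + - \<alpha> * w)"
  proof
    fix z
    have "\<alpha> ^ d = \<alpha> * a" using \<alpha> d by (metis One_nat_def Suc_diff_1 less_le_trans pos2 power_Suc)
    have "\<alpha> * z + - \<alpha> * w = \<alpha> * (z - w)" by (simp add: algebra_simps)
    then have "(\<alpha> * z + - \<alpha> * w) ^ d = \<alpha> * a * (z - w) ^ d"
      by (simp add: power_mult_distrib \<open>\<alpha> ^ d = \<alpha> * a\<close>)
    then show "((\<lambda>z. \<alpha> * z + - \<alpha> * w) \<circ> poly f) z =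
      ((\<lambda>z. z ^ degree f + \<alpha> * (b - w)) \<circ> (\<lambda>z. \<alpha> * z + - \<alpha> * w)) z"
      by (simp add: f d_def[symmetric] algebra_simps)
  qed
  ultimately show ?thesis by (rule that)
qed

text \<open>Vieta's formulas together with \<open>p2 = e1^2 - 2 e2\<close>; the multiset
  \<open>A\<close> lists the roots with multiplicity.\<close>

lemma sum_and_sum_squares_of_roots:
  fixes Q :: "complex poly"
  assumes "lead_coeff Q = 1" "degree Q \<ge> 2"
  obtains A where "size A = degree Q" "\<And>x. x \<in># A \<Longrightarrow> poly Q x = 0"
    "\<Sum>\<^sub># A = - coeff Q (degree Q - 1)"
    "(\<Sum>x\<in>#A. x ^ 2) = coeff Q (degree Q - 1) ^ 2 - 2 * coeff Q (degree Q - 2)"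
proof -
  have "Q \<noteq> 0" using assms by auto
  then obtain A where A: "size A = degree Q" "Q = (\<Prod>x\<in>#A. [:- x, 1:])"
    using alg_closed_imp_factorization[of Q] assms(1) by auto
  have root: "poly Q x = 0" if x: "x \<in># A" for x
  proof -
    obtain A' where "A = add_mset x A'" using multi_member_split[OF x] by blast
    then show ?thesis by (subst A(2)) simp
  qed
  \<comment> \<open>The elementary symmetric functions are read off the reflected polynomial from the bottom.\<close>
  have refl: "reflect_poly (\<Prod>x\<in>#B. [:- x, 1:]) = (\<Prod>x\<in>#B. [:1, - x:])" for B :: "complex multiset"
  proof (induction B)
    case (add x B)
    have "reflect_poly [:- x, 1:] = [:1, - x:]" by (simp add: reflect_poly_pCons' monom_Suc monom_0)
    with add.IH show ?case
      by (simp only: image_mset_add_mset prod_mset.add_mset reflect_poly_mult)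
  qed simp
  have coeffs: "coeff (\<Prod>x\<in>#B. [:1, - x:]) 0 = 1 \<and> coeff (\<Prod>x\<in>#B. [:1, - x:]) 1 = - \<Sum>\<^sub># B \<and>
      (\<Sum>x\<in>#B. x ^ 2) = coeff (\<Prod>x\<in>#B. [:1, - x:]) 1 ^ 2 - 2 * coeff (\<Prod>x\<in>#B. [:1, - x:]) 2"
    for B :: "complex multiset"
    by (induction B) (auto simp: coeff_pCons numeral_2_eq_2 power2_eq_square algebra_simps)
  have "coeff (\<Prod>x\<in>#A. [:1, - x:]) i = coeff Q (degree Q - i)" if "i \<le> 2" for i
  proof -
    have "(\<Prod>x\<in>#A. [:1, - x:]) = reflect_poly Q" using refl[of A] A(2) by simp
    then show ?thesis using that assms(2) by (simp add: coeff_reflect_poly)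
  qed
  then have "coeff (\<Prod>x\<in>#A. [:1, - x:]) 1 = coeff Q (degree Q - 1)"
      "coeff (\<Prod>x\<in>#A. [:1, - x:]) 2 = coeff Q (degree Q - 2)" by simp_all
  then show ?thesis using that[of A] A(1) root coeffs[of A] by simp
qed

section \<open>Multipliers of cycles of period 1, 2 and 4\<close>

definition rational_multipliers :: "nat \<Rightarrow> complex \<Rightarrow> bool" where
  "rational_multipliers d c \<longleftrightarrow>
     (\<forall>z. periodic_point (\<lambda>z. z ^ d + c) z \<longrightarrow> multiplier (\<lambda>z. z ^ d + c) z \<in> \<rat>)"

lemma rational_multipliersD:
  fixes c z :: complex and d :: nat
  defines "g \<equiv> \<lambda>z. z ^ d + c"
  assumes "rational_multipliers d c" "(g ^^ n) z = z" "n \<ge> 1"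
    "\<And>m. 1 \<le> m \<Longrightarrow> m < n \<Longrightarrow> (g ^^ m) z \<noteq> z"
  shows "(\<Prod>i<n. of_nat d * (g ^^ i) z ^ (d - 1)) \<in> \<rat>"
  using assms(2) multiplier_power_plus_const[of n d c z] assms(3-5)
  unfolding rational_multipliers_def g_def by metis

lemma rational_multiplier_fixed_point:
  assumes "rational_multipliers d c" "z ^ d + c = z"
  shows "of_nat d * z ^ (d - 1) \<in> \<rat>"
  using rational_multipliersD[of d c 1 z] assms by simp

lemma rational_multiplier_2_cycle:
  assumes "rational_multipliers d c" "x ^ d + c = y" "y ^ d + c = x" "x \<noteq> y"
  shows "of_nat d ^ 2 * (x * y) ^ (d - 1) \<in> \<rat>"
proof -
  have "((\<lambda>z. z ^ d + c) ^^ m) x \<noteq> x" if "1 \<le> m" "m < 2" for m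
  proof -
    have "m = 1" using that by simp
    then show ?thesis using assms(2,4) by simp
  qed
  then have "(\<Prod>i<2. of_nat d * ((\<lambda>z. z ^ d + c) ^^ i) x ^ (d - 1)) \<in> \<rat>"
    using assms(1-3) by (intro rational_multipliersD) (simp_all add: numeral_2_eq_2)
  then show ?thesis
    using assms(2) by (simp add: numeral_2_eq_2 power_mult_distrib mult_ac)
qed

lemma rational_multiplier_4_cycle:
  assumes "rational_multipliers d c" "x0 ^ d + c = x1" "x1 ^ d + c = x2" "x2 ^ d + c = x3"
    "x3 ^ d + c = x0" "x0 \<noteq> x2"
  shows "of_nat d ^ 4 * (x0 * x1 * x2 * x3) ^ (d - 1) \<in> \<rat>"
proof -
  define g where "g = (\<lambda>z. z ^ d + c)"
  have g: "g x0 = x1" "g x1 = x2" "g x2 = x3" "g x3 = x0" using assms by (simp_all add: g_def)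
  \<comment> \<open>Either equality would make \<open>x0\<close> a fixed point, contradicting
    \<open>x0 \<noteq> x2\<close>. So the exact period is 4.\<close>
  have "x1 \<noteq> x0" "x3 \<noteq> x0" using g assms(6) by auto
  have "(g ^^ m) x0 \<noteq> x0" if "1 \<le> m" "m < 4" for m
  proof -
    have "m = 1 \<or> m = 2 \<or> m = 3" using that by auto
    then show ?thesis using g assms(6) \<open>x1 \<noteq> x0\<close> \<open>x3 \<noteq> x0\<close> by (auto simp: eval_nat_numeral)
  qed
  moreover have "(g ^^ 4) x0 = x0" using g by (simp add: eval_nat_numeral)
  ultimately have "(\<Prod>i<4. of_nat d * (g ^^ i) x0 ^ (d - 1)) \<in> \<rat>"
    unfolding g_def using assms(1) by (intro rational_multipliersD) simp_all
  then show ?thesis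
    using g by (simp add: eval_nat_numeral power_mult_distrib mult_ac)
qed

lemma Rats_imp_Reals_complex: "(x :: complex) \<in> \<rat> \<Longrightarrow> x \<in> \<real>"
  by (metis Rats_cases' Reals_divide Reals_of_int)

lemma sum_squares_mset_eq_0:
  fixes h :: "'a \<Rightarrow> real"
  assumes "(\<Sum>x\<in>#A. h x ^ 2) = 0" "x \<in># A"
  shows "h x = 0"
proof -
  obtain B where B: "A = add_mset x B" using multi_member_split[OF assms(2)] by blast
  have "(\<Sum>x\<in>#B. h x ^ 2) \<ge> 0" by (induction B) auto
  moreover have "h x ^ 2 \<ge> 0" by simp
  moreover have "h x ^ 2 + (\<Sum>x\<in>#B. h x ^ 2) = 0" using assms(1) B by simp
  ultimately have "h x ^ 2 = 0" by linarith
  then show ?thesis by simp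
qed

subsection \<open>Degree at least 3\<close>

lemma fixed_points_collinear:
  fixes c :: complex
  assumes rat: "rational_multipliers d c" and d: "d \<ge> 3" and c: "c \<noteq> 0"
  obtains A :: "complex multiset" where "size A = d" "0 \<notin># A" "\<And>z. z \<in># A \<Longrightarrow> z / c \<in> \<real>"
    "(\<Sum>z\<in>#A. z ^ 2) = (if d = 3 then 2 else 0)"
proof -
  define Q :: "complex poly" where "Q = monom 1 d + [:c, -1:]"
  have co: "coeff Q i = (if i = d then 1 else if i = 0 then c else if i = 1 then -1 else 0)" for i
    using d by (auto simp: Q_def coeff_pCons split: nat.split)
  have "degree [:c, -1:] < degree (monom (1 :: complex) d)" using d by (simp add: degree_monom_eq)
  then have deg: "degree Q = d" unfolding Q_def by (simp add: degree_add_eq_left degree_monom_eq)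
  have root: "z ^ d + c = z" if "poly Q z = 0" for z
    using that by (simp add: Q_def poly_monom algebra_simps add_eq_0_iff)
  obtain A where A: "size A = degree Q" "\<And>x. x \<in># A \<Longrightarrow> poly Q x = 0"
      "(\<Sum>x\<in>#A. x ^ 2) = coeff Q (degree Q - 1) ^ 2 - 2 * coeff Q (degree Q - 2)"
    using sum_and_sum_squares_of_roots[of Q] deg d by (auto simp: co)
  show ?thesis
  proof (rule that)
    show "size A = d" using A(1) deg by simp
    show "0 \<notin># A" using root[OF A(2)[of 0]] c d by (auto simp: power_0_left)
    \<comment> \<open>In \<open>z^d - z + c\<close> the coefficient of \<open>z^(d-1)\<close> is 0.
      That of \<open>z^(d-2)\<close> is 0 as well, except for \<open>d = 3\<close>, where it is the
      linear coefficient -1.\<close>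
    show "(\<Sum>z\<in>#A. z ^ 2) = (if d = 3 then 2 else 0)"
      unfolding A(3) deg co using d by auto
    fix z assume "z \<in># A"
    then have fp: "z ^ d + c = z" using A(2) root by blast
    have "of_nat d * z ^ (d - 1) \<in> \<rat>" using rat fp by (rule rational_multiplier_fixed_point)
    then have "of_nat d * z ^ (d - 1) / of_nat d \<in> \<rat>" by (intro Rats_divide) auto
    then have "z ^ (d - 1) \<in> \<real>" using d by (auto intro: Rats_imp_Reals_complex)
    moreover have "z * (1 - z ^ (d - 1)) = c"
    proof -
      have "z ^ d = z * z ^ (d - 1)" using d by (simp add: power_eq_if)
      with fp show ?thesis by (simp add: algebra_simps)
    qed
    then have "1 - z ^ (d - 1) \<noteq> 0" "z / c = 1 / (1 - z ^ (d - 1))"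
      using c by (auto simp: frac_eq_eq)
    ultimately show "z / c \<in> \<real>" by simp
  qed
qed

text \<open>With \<open>r\<close> the sum of the squares of the nonzero reals \<open>z / c\<close>,
  the sum of the \<open>z^2\<close> is \<open>c^2 r\<close> with \<open>r > 0\<close>. It cannot
  vanish, which leaves \<open>d = 3\<close> and \<open>c^2 = 2 / r\<close>.\<close>

lemma rational_multipliers_degree_ge_3:
  fixes c :: complex
  assumes rat: "rational_multipliers d c" and d: "d \<ge> 3" and c: "c \<noteq> 0"
  obtains r where "d = 3" "r > 0" "c ^ 2 = complex_of_real r"
proof -
  obtain A where A: "size A = d" "0 \<notin># A" "\<And>z. z \<in># A \<Longrightarrow> z / c \<in> \<real>"
      "(\<Sum>z\<in>#A. z ^ 2) = (if d = 3 then 2 else 0)"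
    using fixed_points_collinear[OF assms] by blast
  define r where "r = (\<Sum>z\<in>#A. Re (z / c) ^ 2)"
  have "z ^ 2 = c ^ 2 * of_real (Re (z / c) ^ 2)" if "z \<in># A" for z
  proof -
    have "z = c * of_real (Re (z / c))" using A(3)[OF that] c by (simp add: of_real_Re)
    then show ?thesis by (metis of_real_power power_mult_distrib)
  qed
  then have "(\<Sum>z\<in>#A. z ^ 2) = (\<Sum>z\<in>#A. c ^ 2 * of_real (Re (z / c) ^ 2))"
    by (intro arg_cong[where f = sum_mset] image_mset_cong) auto
  also have "\<dots> = c ^ 2 * of_real r"
    unfolding r_def by (induction A) (simp_all add: algebra_simps)
  finally have eq: "c ^ 2 * of_real r = (if d = 3 then 2 else 0)" using A(4) by simp
  have "r \<noteq> 0"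
  proof
    assume "r = 0"
    obtain z where z: "z \<in># A" using A(1) d by (metis multiset_nonemptyE not_numeral_le_zero size_empty)
    then have "Re (z / c) = 0" using \<open>r = 0\<close> sum_squares_mset_eq_0 unfolding r_def by fast
    then have "z / c = 0" using A(3)[OF z] by (auto simp: complex_is_Real_iff complex_eq_iff)
    then show False using A(2) z c by auto
  qed
  moreover have "r \<ge> 0" unfolding r_def by (induction A) auto
  ultimately have "r > 0" by simp
  with eq c have "d = 3" by (auto split: if_splits)
  show ?thesis
  proof (rule that[of "2 / r"])
    show "d = 3" "2 / r > 0" using \<open>d = 3\<close> \<open>r > 0\<close> by auto
    show "c ^ 2 = complex_of_real (2 / r)" using eq \<open>d = 3\<close> \<open>r > 0\<close> by (simp add: field_simps)
  qed
qed

text \<open>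
  For a 2-cycle \<open>{x, y}\<close> of \<open>z^3 + c\<close> put \<open>S = x + y\<close> and \<open>u = x y\<close>. Then \<open>S^2 = u - 1\<close> and
  \<open>S (u + 1) = c\<close>. The excluded value \<open>u = -1/3\<close> is the one where \<open>x = y\<close>.
\<close>

lemma degree_3_multiplier_2_cycle:
  fixes c u :: complex
  assumes rat: "rational_multipliers 3 c" and u: "(u - 1) * (u + 1) ^ 2 = c ^ 2"
    and nz: "u \<noteq> - 1" "u \<noteq> - 1 / 3"
  shows "u ^ 2 \<in> \<rat>"
proof -
  define S where "S = c / (u + 1)"
  have u1: "u + 1 \<noteq> 0" using nz(1) by (simp add: add_eq_0_iff2)
  have S2: "S ^ 2 = u - 1" using u u1 by (simp add: S_def power_divide field_simps)
  have c: "c = S * (u + 1)" using u1 by (simp add: S_def)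
  define D where "D = csqrt (S ^ 2 - 4 * u)"
  have D2: "D ^ 2 = S ^ 2 - 4 * u" by (simp add: D_def)
  have "1 + 3 * u \<noteq> 0"
  proof
    assume "1 + 3 * u = 0"
    then have "3 * u = 3 * (- 1 / 3)" by (simp add: add_eq_0_iff)
    then have "u = - 1 / 3" by (simp only: mult_cancel_left) simp
    with nz(2) show False by simp
  qed
  moreover have "D ^ 2 = - (1 + 3 * u)" unfolding D2 S2 by simp
  ultimately have "D ^ 2 \<noteq> 0" by (simp only: neg_equal_0_iff_equal not_False_eq_True)
  then have "D \<noteq> 0" by auto
  \<comment> \<open>The cubic map sends each root of \<open>X^2 - S X + u\<close> to the other
    one.\<close>
  have cyc: "x ^ 3 + c = S - x" if "x ^ 2 = S * x - u" for x
  proof -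
    have "x ^ 3 = x * x ^ 2" by (simp add: power2_eq_square power3_eq_cube)
    also have "\<dots> = x * (S * x - u)" unfolding that ..
    also have "\<dots> = S * x ^ 2 - u * x" by (simp add: power2_eq_square algebra_simps)
    also have "\<dots> = S ^ 2 * x - S * u - u * x" unfolding that by (simp add: power2_eq_square algebra_simps)
    finally show ?thesis unfolding S2 c by (simp add: algebra_simps)
  qed
  define x where "x = (S + D) / 2"
  define y where "y = (S - D) / 2"
  have xy: "x * y = u" "y = S - x" "x = S - y" "x \<noteq> y"
  proof -
    have "x * y = (S ^ 2 - D ^ 2) / 4" by (simp add: x_def y_def power2_eq_square field_simps)
    then show "x * y = u" unfolding D2 by simp
    have "x + y = S" by (simp add: x_def y_def field_simps)
    then show "y = S - x" "x = S - y" by auto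
    have "x - y = D" by (simp add: x_def y_def field_simps)
    then show "x \<noteq> y" using \<open>D \<noteq> 0\<close> by auto
  qed
  have "x * (S - x) = u" using xy(1) unfolding xy(2) .
  then have "x ^ 2 = S * x - u" by (auto simp: power2_eq_square algebra_simps)
  have "(S - y) * y = u" using xy(1) unfolding xy(3) .
  then have "y ^ 2 = S * y - u" by (auto simp: power2_eq_square algebra_simps)
  have "x ^ 3 + c = y" "y ^ 3 + c = x"
    using cyc[OF \<open>x ^ 2 = S * x - u\<close>] cyc[OF \<open>y ^ 2 = S * y - u\<close>]
    by (simp_all only: xy(2,3)[symmetric])
  then have "of_nat 3 ^ 2 * (x * y) ^ (3 - 1) \<in> \<rat>"
    using rat xy(4) by (intro rational_multiplier_2_cycle)
  then have "9 * u ^ 2 / 9 \<in> \<rat>" using xy(1) by (intro Rats_divide) simp_all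
  then show ?thesis by simp
qed

lemma degree_3_not_rational_multipliers:
  fixes c :: complex
  assumes rat: "rational_multipliers 3 c" and r: "c ^ 2 = of_real r" "r > 0"
  shows False
proof -
  define Q :: "complex poly" where "Q = [:-1 - c ^ 2, -1, 1, 1:]"
  have Q: "poly Q u = (u - 1) * (u + 1) ^ 2 - c ^ 2" for u
    by (simp add: Q_def power2_eq_square algebra_simps)
  have "degree Q = 3" "lead_coeff Q = 1" by (simp_all add: Q_def)
  then obtain A where A: "size A = 3" "\<And>x. x \<in># A \<Longrightarrow> poly Q x = 0" "\<Sum>\<^sub># A = - coeff Q 2"
    using sum_and_sum_squares_of_roots[of Q] by (auto simp: numeral_3_eq_3 numeral_2_eq_2)
  have Re: "Re u \<ge> 1" if "u \<in># A" for u
  proof -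
    have eq: "(u - 1) * (u + 1) ^ 2 = of_real r" using A(2)[OF that] r by (simp add: Q)
    have "u \<noteq> - 1"
      using eq r(2) by auto
    moreover have "u \<noteq> - 1 / 3"
    proof
      assume "u = - 1 / 3"
      with eq have "complex_of_real (- 16 / 27) = of_real r" by (simp add: power2_eq_square)
      then show False using r(2) by (simp only: of_real_eq_iff)
    qed
    ultimately have "u ^ 2 \<in> \<rat>" using degree_3_multiplier_2_cycle[OF rat] eq r(1) by simp
    then have "u ^ 2 \<in> \<real>" by (rule Rats_imp_Reals_complex)
    \<comment> \<open>A real square leaves \<open>u\<close> real or purely imaginary. In the
      imaginary case the left side of \<open>eq\<close> has real part at most -1, but
      \<open>r > 0\<close>.\<close>
    then have "Re u = 0 \<or> Im u = 0" by (auto simp: complex_is_Real_iff power2_eq_square)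
    then consider "Re u = 0" | "Im u = 0" by auto
    then show ?thesis
    proof cases
      case 1
      have "Re ((u - 1) * (u + 1) ^ 2) = - (1 + Im u ^ 2)"
        using 1 by (simp add: power2_eq_square algebra_simps)
      then have "- (1 + Im u ^ 2) = r" unfolding eq by simp
      moreover have "Im u ^ 2 \<ge> 0" by simp
      ultimately show ?thesis using r(2) by linarith
    next
      case 2
      have "Re ((u - 1) * (u + 1) ^ 2) = (Re u - 1) * (Re u + 1) ^ 2"
        using 2 by (simp add: power2_eq_square algebra_simps)
      then have "(Re u - 1) * (Re u + 1) ^ 2 > 0" using eq r(2) by simp
      then have "Re u - 1 > 0" by (auto simp: zero_less_mult_iff)
      then show ?thesis by simp
    qed
  qed
  have sum_ge: "Re (\<Sum>\<^sub># B) \<ge> real (size B)" if "\<And>u. u \<in># B \<Longrightarrow> Re u \<ge> 1" for B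
    using that by (induction B) force+
  have "Re (\<Sum>\<^sub># A) \<ge> 3" using sum_ge[of A] Re A(1) by simp
  with A(3) show False by (simp add: Q_def numeral_2_eq_2)
qed

subsection \<open>Degree 2\<close>

text \<open>
  For a 4-cycle \<open>x \<mapsto> x' \<mapsto> y \<mapsto> y'\<close> of \<open>z^2 + c\<close> put \<open>A = x + y\<close>, \<open>B = x' + y'\<close>, \<open>P = x y\<close> and
  \<open>Q = x' y'\<close>. Then \<open>x' - y' = A (x - y)\<close> and \<open>y - x = B (x' - y')\<close> give \<open>A B = -1\<close>, and summing the
  equations of the cycle in pairs determines \<open>P\<close> and \<open>Q\<close>. The root \<open>T = -2\<close> is excluded because
  there \<open>x = y\<close> may occur.
\<close>

lemma degree_2_multiplier_4_cycle:
  fixes c T :: complex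
  assumes rat: "rational_multipliers 2 c" and c: "c \<in> \<rat>"
    and T: "T ^ 3 + (3 + 4 * c) * T + 4 = 0" "T \<noteq> - 2"
  shows "8 * c * (T ^ 2 + T) + 16 * (1 + c + c ^ 2) \<in> \<rat>"
proof -
  \<comment> \<open>The sums \<open>A\<close> and \<open>B\<close> of the opposite pairs are to have
    sum \<open>T\<close> and product -1.\<close>
  obtain A where A: "A ^ 2 - T * A - 1 = 0"
  proof -
    have "degree [:- 1, - T, 1:] > 0" by simp
    from alg_closed_imp_poly_has_root[OF this] obtain A where "poly [:- 1, - T, 1:] A = 0" by blast
    then show ?thesis using that by (simp add: power2_eq_square algebra_simps)
  qed
  define B where "B = T - A"
  have T_eq: "T = A + B" by (simp add: B_def)
  have AB: "A * B = - 1" using A by (simp add: B_def power2_eq_square algebra_simps)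
  have sq: "A ^ 2 + B ^ 2 = T ^ 2 + 2"
  proof -
    have "T ^ 2 = A ^ 2 + B ^ 2 + 2 * (A * B)" unfolding T_eq by (simp add: power2_eq_square algebra_simps)
    then show ?thesis unfolding AB by simp
  qed
  have cu: "A ^ 3 + B ^ 3 = - 4 * c * T - 4"
  proof -
    have "T ^ 3 = A ^ 3 + B ^ 3 + 3 * (A * B) * T"
      unfolding T_eq by (simp add: power3_eq_cube algebra_simps)
    then have "A ^ 3 + B ^ 3 = T ^ 3 + 3 * T" unfolding AB by simp
    also have "\<dots> = (T ^ 3 + (3 + 4 * c) * T + 4) - 4 * c * T - 4" by (simp add: algebra_simps)
    finally show ?thesis unfolding T(1) by simp
  qed
  have A2B: "A ^ 2 * B = - A" using AB by (simp add: power2_eq_square mult.assoc)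
  have E: "A ^ 4 + 4 * c * A ^ 2 = B ^ 2 - 4 * A + 4 * c"
  proof -
    have "A * (A ^ 3 + B ^ 3) = A ^ 4 + (A * B) * B ^ 2"
      by (simp add: power2_eq_square power3_eq_cube power4_eq_xxxx algebra_simps)
    moreover have "A * (- 4 * c * T - 4) = - 4 * c * (A ^ 2 + A * B) - 4 * A"
      unfolding T_eq by (simp add: power2_eq_square algebra_simps)
    ultimately show ?thesis unfolding cu AB by (simp add: algebra_simps)
  qed
  then have A4: "A ^ 4 = B ^ 2 - 4 * A + 4 * c - 4 * c * A ^ 2" by (simp add: algebra_simps)
  define P where "P = (A ^ 2 - B + 2 * c) / 2"
  define Q where "Q = (B ^ 2 - A + 2 * c) / 2"
  have sqPc: "(P - c) ^ 2 = (A ^ 4 + 2 * A + B ^ 2) / 4"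
  proof -
    have "P - c = (A ^ 2 - B) / 2" by (simp add: P_def field_simps)
    then have "(P - c) ^ 2 = ((A ^ 2 - B) / 2) ^ 2" by (simp only:)
    also have "\<dots> = (A ^ 4 - 2 * (A ^ 2 * B) + B ^ 2) / 4"
      by (simp add: power2_eq_square power4_eq_xxxx field_simps)
    finally show ?thesis unfolding A2B by simp
  qed
  \<comment> \<open>Consistency condition: the right side is \<open>(x^2 + c) (y^2 + c)\<close> when
    \<open>x + y = A\<close> and \<open>x y = P\<close>.\<close>
  have Q_eq: "Q = (P - c) ^ 2 + c * A ^ 2"
    unfolding sqPc Q_def A4 by (simp add: field_simps)
  \<comment> \<open>The second iterate exchanges the two roots of
    \<open>X^2 - A X + P\<close>.\<close>
  have cyc: "(x ^ 2 + c) ^ 2 + c = A - x" if x: "x ^ 2 = A * x - P" for x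
  proof -
    have "x ^ 2 + c = A * x - (P - c)" using x by simp
    then have "(x ^ 2 + c) ^ 2 = (A * x - (P - c)) ^ 2" by (simp only:)
    also have "\<dots> = A ^ 2 * x ^ 2 - 2 * A * (P - c) * x + (P - c) ^ 2"
      by (simp add: power2_eq_square algebra_simps)
    also have "\<dots> = A * (A ^ 2 - 2 * (P - c)) * x - A ^ 2 * P + (P - c) ^ 2"
      unfolding x by (simp add: power2_eq_square algebra_simps)
    also have "A ^ 2 - 2 * (P - c) = B" by (simp add: P_def field_simps)
    also have "A ^ 2 * P = (A ^ 4 + A + 2 * c * A ^ 2) / 2"
    proof -
      have "A ^ 2 * P = (A ^ 4 - A ^ 2 * B + 2 * c * A ^ 2) / 2"
        by (simp add: P_def power2_eq_square power4_eq_xxxx field_simps)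
      then show ?thesis unfolding A2B by simp
    qed
    finally have "(x ^ 2 + c) ^ 2 = - x - (A ^ 4 + A + 2 * c * A ^ 2) / 2 + (A ^ 4 + 2 * A + B ^ 2) / 4"
      unfolding AB sqPc by simp
    also have "\<dots> = A - x - c" unfolding A4 by (simp add: field_simps)
    finally show ?thesis by simp
  qed
  define D where "D = csqrt (A ^ 2 - 4 * P)"
  have D2: "D ^ 2 = A ^ 2 - 4 * P" by (simp add: D_def)
  \<comment> \<open>If the roots coincide, eliminating \<open>c\<close> from \<open>E\<close> gives
    \<open>(B - A) (A + B + 2) = 0\<close>. The second factor is \<open>T + 2\<close>, and
    \<open>A = B\<close> forces \<open>A^2 = -1\<close>, which makes \<open>c\<close>
    non-real.\<close>
  have "D \<noteq> 0"
  proof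
    assume "D = 0"
    then have "A ^ 2 - 4 * P = 0" using D2 by simp
    moreover have "4 * c = 2 * B - A ^ 2 - (A ^ 2 - 4 * P)" by (simp add: P_def field_simps)
    ultimately have c4: "4 * c = 2 * B - A ^ 2" by simp
    have "(B - A) * (A + B + 2) = (B ^ 2 - 4 * A + (2 * B - A ^ 2)) + 2 * A"
      by (simp add: power2_eq_square algebra_simps)
    also have "\<dots> = A ^ 4 + (2 * B - A ^ 2) * A ^ 2 + 2 * A" using E unfolding c4 by simp
    also have "\<dots> = 2 * (A ^ 2 * B) + 2 * A"
      by (simp add: power2_eq_square power4_eq_xxxx algebra_simps)
    finally have "(B - A) * (A + B + 2) = 0" unfolding A2B by simp
    moreover have "A + B + 2 \<noteq> 0" using T(2) T_eq by (simp add: add_eq_0_iff2)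
    ultimately have "B = A" by simp
    then have "A ^ 2 = - 1" using AB by (simp add: power2_eq_square)
    then have "A ^ 3 = - A" by (simp add: power3_eq_cube power2_eq_square)
    with cu \<open>B = A\<close> T_eq have "A * (8 * c - 2) = - 4" by (simp add: algebra_simps)
    have "- ((8 * c - 2) ^ 2) = A ^ 2 * (8 * c - 2) ^ 2" unfolding \<open>A ^ 2 = - 1\<close> by simp
    also have "\<dots> = (A * (8 * c - 2)) ^ 2" by (simp only: power_mult_distrib)
    also have "\<dots> = 16" unfolding \<open>A * (8 * c - 2) = - 4\<close> by simp
    finally have *: "(8 * c - 2) ^ 2 = - 16" by (metis minus_minus)
    obtain s where "c = complex_of_real s" using Rats_imp_Reals_complex[OF c] by (auto elim: Reals_cases)
    with * have "complex_of_real ((8 * s - 2) ^ 2) = of_real (- 16)" by simp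
    then have "(8 * s - 2) ^ 2 = - 16" by (simp only: of_real_eq_iff)
    moreover have "(8 * s - 2) ^ 2 \<ge> 0" by simp
    ultimately show False by simp
  qed
  define x where "x = (A + D) / 2"
  define y where "y = (A - D) / 2"
  have xy: "x * y = P" "y = A - x" "x = A - y" "x \<noteq> y"
  proof -
    have "x * y = (A ^ 2 - D ^ 2) / 4" by (simp add: x_def y_def power2_eq_square field_simps)
    then show "x * y = P" unfolding D2 by simp
    have "x + y = A" by (simp add: x_def y_def field_simps)
    then show "y = A - x" "x = A - y" by auto
    have "x - y = D" by (simp add: x_def y_def field_simps)
    then show "x \<noteq> y" using \<open>D \<noteq> 0\<close> by auto
  qed
  have "x * (A - x) = P" using xy(1) unfolding xy(2) .
  then have x2: "x ^ 2 = A * x - P" by (auto simp: power2_eq_square algebra_simps)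
  have "(A - y) * y = P" using xy(1) unfolding xy(3) .
  then have y2: "y ^ 2 = A * y - P" by (auto simp: power2_eq_square algebra_simps)
  have "of_nat 2 ^ 4 * (x * (x ^ 2 + c) * y * (y ^ 2 + c)) ^ (2 - 1) \<in> \<rat>"
    by (rule rational_multiplier_4_cycle[OF rat])
      (use cyc[OF x2] cyc[OF y2] xy(4) in \<open>simp_all add: xy(2,3)[symmetric]\<close>)
  moreover have "x * (x ^ 2 + c) * y * (y ^ 2 + c) = P * Q"
  proof -
    have "(x ^ 2 + c) * (y ^ 2 + c) = (x * y) ^ 2 + c * ((x + y) ^ 2 - 2 * (x * y)) + c ^ 2"
      by (simp add: power2_eq_square algebra_simps)
    also have "x + y = A" using xy(2) by simp
    finally have "(x ^ 2 + c) * (y ^ 2 + c) = Q"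
      unfolding xy(1) Q_eq by (simp add: power2_eq_square algebra_simps)
    then show ?thesis unfolding xy(1)[symmetric] by (simp add: mult_ac)
  qed
  moreover have "16 * (P * Q) = 8 * c * (T ^ 2 + T) + 16 * (1 + c + c ^ 2)"
  proof -
    have "16 * (P * Q) = 4 * (4 * (P * Q))" by simp
    also have "4 * (P * Q) = (A * B) * (A * B) - (A ^ 3 + B ^ 3) + A * B + 2 * c * (A ^ 2 + B ^ 2)
        - 2 * c * (A + B) + 4 * c ^ 2"
      by (simp add: P_def Q_def power2_eq_square power3_eq_cube field_simps)
    finally show ?thesis unfolding AB cu sq T_eq[symmetric]
      by (simp add: power2_eq_square algebra_simps)
  qed
  ultimately show ?thesis by simp
qed

lemma rational_multipliers_degree_2:
  fixes c :: complex
  assumes rat: "rational_multipliers 2 c"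
  shows "c = 0 \<or> c = - 2"
proof (rule ccontr)
  assume "\<not> (c = 0 \<or> c = - 2)"
  then have c: "c \<noteq> 0" "c \<noteq> - 2" by auto
  have root: "\<exists>z. poly [:a, b, 1:] z = 0" "\<exists>z. poly [:a, b, 0, 1:] z = 0" for a b :: complex
    by (rule alg_closed_imp_poly_has_root; simp)+
  obtain z where z: "z ^ 2 + c = z"
    using root(1)[of c "-1"] by (auto simp: power2_eq_square algebra_simps add_eq_0_iff)
  \<comment> \<open>A fixed point has multiplier \<open>2 z\<close>, so \<open>z\<close> and with it
    \<open>c = z - z^2\<close> are rational.\<close>
  have "2 * z / 2 \<in> \<rat>" using rational_multiplier_fixed_point[OF rat z] by (intro Rats_divide) auto
  then have "z \<in> \<rat>" by simp
  moreover have "c = z - z ^ 2" using z by (simp add: algebra_simps)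
  ultimately have cQ: "c \<in> \<rat>" by simp
  have T_rat: "T \<in> \<rat>" if T: "T ^ 3 + (3 + 4 * c) * T + 4 = 0" for T
  proof (cases "T = - 2")
    case False
    define V where "V = T ^ 2 + T"
    have "8 * c * V + 16 * (1 + c + c ^ 2) \<in> \<rat>"
      unfolding V_def using rat cQ T False by (rule degree_2_multiplier_4_cycle)
    then have "(8 * c * V + 16 * (1 + c + c ^ 2) - 16 * (1 + c + c ^ 2)) / (8 * c) \<in> \<rat>"
      by (intro Rats_divide Rats_diff) (use cQ in auto)
    then have V: "V \<in> \<rat>" using c(1) by simp
    \<comment> \<open>Reducing the cubic modulo \<open>T^2 = V - T\<close> leaves a linear equation, trivial only if \<open>c = -2\<close>.\<close>
    have "T ^ 3 = (V - T) * T" by (simp add: V_def power2_eq_square power3_eq_cube)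
    also have "\<dots> = V * T - T ^ 2" by (simp add: power2_eq_square algebra_simps)
    also have "T ^ 2 = V - T" by (simp add: V_def)
    finally have "T ^ 3 = V * T - V + T" by simp
    with T have lin: "(V + 4 + 4 * c) * T = V - 4" by (simp add: algebra_simps)
    show ?thesis
    proof (cases "V + 4 + 4 * c = 0")
      case True
      with lin have "V = 4" by simp
      with True have "4 * c = 4 * (- 2)" by (simp add: add_eq_0_iff)
      then show ?thesis using c(2) by simp
    next
      case False
      with lin have "T = (V - 4) / (V + 4 + 4 * c)" by (simp add: field_simps)
      also have "\<dots> \<in> \<rat>" using V cQ by simp
      finally show ?thesis .
    qed
  qed simp
  obtain x where "poly [:4, 3 + 4 * c, 0, 1:] x = 0" using root(2) by blast
  then have x: "x ^ 3 + (3 + 4 * c) * x + 4 = 0" by (simp add: power3_eq_cube algebra_simps)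
  \<comment> \<open>The quadratic is the quotient of the cubic by \<open>T - x\<close>, so
    \<open>y\<close> is a second root. The third root is \<open>- (x + y)\<close>, and the product
    of all three is -4.\<close>
  obtain y where "poly [:x ^ 2 + 3 + 4 * c, x, 1:] y = 0" using root(1) by blast
  then have y: "3 + 4 * c = - (x ^ 2 + x * y + y ^ 2)"
    by (simp add: power2_eq_square algebra_simps add_eq_0_iff)
  have "x * y * (x + y) = 4"
    using x unfolding y by (simp add: power2_eq_square power3_eq_cube algebra_simps)
  moreover have "y ^ 3 + (3 + 4 * c) * y + 4 = 0"
    using calculation unfolding y by (simp add: power2_eq_square power3_eq_cube algebra_simps)
  ultimately show False using Rats_product_neq_four T_rat x by blast
qed

section \<open>Combining the normal form with the degree cases\<close>

theorem theorem6:
  fixes f :: "complex poly"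
  assumes "unicritical f"
    and "\<And>z. periodic_point (poly f) z \<Longrightarrow> multiplier (poly f) z \<in> \<rat>"
  shows "power_map f \<or> chebyshev_map f"
proof -
  define d where "d = degree f"
  have d: "d \<ge> 2" using assms(1) by (simp add: unicritical_def d_def)
  obtain a b c where a: "a \<noteq> 0"
    and conj: "(\<lambda>z. a * z + b) \<circ> poly f = (\<lambda>z. z ^ d + c) \<circ> (\<lambda>z. a * z + b)"
    using unicritical_normal_form[OF assms(1)] unfolding d_def by blast
  have diff: "(\<lambda>z. z ^ d + c) field_differentiable at z" for z
    by (intro derivative_intros)
  have rat: "rational_multipliers d c"
    unfolding rational_multipliers_def
  proof (intro allI impI)
    fix w assume "periodic_point (\<lambda>z. z ^ d + c) w"
    moreover have "w = a * ((w - b) / a) + b" using a by simp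
    ultimately show "multiplier (\<lambda>z. z ^ d + c) w \<in> \<rat>"
      using multiplier_affine_conj[OF conj a diff, of "(w - b) / a"] assms(2) by metis
  qed
  have "c = 0 \<or> d = 2 \<and> c = - 2"
  proof (cases "d = 2")
    case True
    then show ?thesis using rat rational_multipliers_degree_2 by blast
  next
    case False
    then have "d \<ge> 3" using d by simp
    then show ?thesis
      using rational_multipliers_degree_ge_3[OF rat] degree_3_not_rational_multipliers rat by metis
  qed
  then show ?thesis
  proof (elim disjE conjE)
    assume "c = 0"
    then show ?thesis
      using conj a d unfolding power_map_def affinely_conjugate_def d_def by auto
  next
    assume "d = 2" "c = - 2"
    \<comment> \<open>The exceptional map \<open>z^2 - 2\<close> is the Chebyshev polynomial of
      degree 2, checked by substituting \<open>w = z + inverse z\<close>.\<close>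
    have "poly (chebyshev_T 2) w = w ^ 2 - 2" for w
    proof -
      obtain z where z: "z \<noteq> 0" "z + inverse z = w" using add_inverse_surj by blast
      have "w ^ 2 = z ^ 2 + inverse z ^ 2 + 2"
        using z by (auto simp: power2_eq_square algebra_simps)
      then show ?thesis using poly_chebyshev_T[OF z(1), of 2] z(2) by simp
    qed
    then have "(\<lambda>z. z ^ d + c) = poly (chebyshev_T (degree f))"
      using \<open>d = 2\<close> \<open>c = - 2\<close> d_def by auto
    then show ?thesis
      using conj a d unfolding chebyshev_map_def affinely_conjugate_def d_def by metis
  qed
qed

end
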